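(* Let $V$ be a model of ZFC in which the class $$C=\{\alpha:\ \alpha \text{ is a cardinal},\ \mathrm{cf}(\alpha)=\omega_1,\ \alpha^{\omega}>\alpha\}$$ is a proper class. Then in $V$ the class $$\{\delta:\ \delta \text{ is a cardinal},\ \mathrm{cf}(\delta)=\omega,\ \delta^{\omega}\geq \delta^{+\omega_1+1}\}$$ is a proper class.
   Context: $\delta^{+\omega_1+1}$ denotes the successor of the $\omega_1$-th cardinal successor $\delta^{+\omega_1}$ of $\delta$. $\alpha^\omega$ denotes cardinal exponentiation. *)

theory Defs
  imports Main
begin

text \<open>
  A model of ZFC is a nonempty domain (here a type \<open>'v\<close>) with an arbitrary binary relation \<open>E\<close>
  (\<open>E x a\<close> reads: \<open>x\<close> is a member of \<open>a\<close>), not assumed well-founded in the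
  metatheory, that satisfies the first-order axioms of ZFC.
  Separation and Replacement are schemas: they are required only for first-order formulas with
  parameters, so \<open>(E, 'v)\<close> need not be a model of second-order ZFC.
\<close>

text \<open>Formulas of the language of set theory, with de Bruijn indices for variables.\<close>

datatype fm = Mem nat nat | Equal nat nat | Neg fm | Conj fm fm | Forall fm

primrec sat :: "('v \<Rightarrow> 'v \<Rightarrow> bool) \<Rightarrow> fm \<Rightarrow> (nat \<Rightarrow> 'v) \<Rightarrow> bool" where
  "sat E (Mem i j) s = E (s i) (s j)"
| "sat E (Equal i j) s = (s i = s j)"
| "sat E (Neg p) s = (\<not> sat E p s)"
| "sat E (Conj p q) s = (sat E p s \<and> sat E q s)"
| "sat E (Forall p) s = (\<forall>x. sat E p (case_nat x s))"

context
  fixes E :: "'v \<Rightarrow> 'v \<Rightarrow> bool"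
begin

definition elts :: "'v \<Rightarrow> 'v set" where
  "elts a = {x. E x a}"

definition extensionality_ax :: bool where
  "extensionality_ax \<longleftrightarrow> (\<forall>a b. elts a = elts b \<longrightarrow> a = b)"

definition foundation_ax :: bool where
  "foundation_ax \<longleftrightarrow> (\<forall>a. elts a \<noteq> {} \<longrightarrow> (\<exists>x\<in>elts a. elts x \<inter> elts a = {}))"

definition pairing_ax :: bool where
  "pairing_ax \<longleftrightarrow> (\<forall>a b. \<exists>c. elts c = {a, b})"

definition union_ax :: bool where
  "union_ax \<longleftrightarrow> (\<forall>a. \<exists>u. elts u = (\<Union>x\<in>elts a. elts x))"

definition power_set_ax :: bool where
  "power_set_ax \<longleftrightarrow> (\<forall>a. \<exists>p. elts p = {x. elts x \<subseteq> elts a})"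

definition infinity_ax :: bool where
  "infinity_ax \<longleftrightarrow>
     (\<exists>w. (\<exists>e\<in>elts w. elts e = {}) \<and>
          (\<forall>x\<in>elts w. \<exists>y\<in>elts w. elts y = insert x (elts x)))"

definition choice_ax :: bool where
  "choice_ax \<longleftrightarrow>
     (\<forall>a. (\<forall>x\<in>elts a. elts x \<noteq> {}) \<and>
          (\<forall>x\<in>elts a. \<forall>y\<in>elts a. x \<noteq> y \<longrightarrow> elts x \<inter> elts y = {}) \<longrightarrow>
          (\<exists>c. \<forall>x\<in>elts a. \<exists>!y. y \<in> elts x \<inter> elts c))"

text \<open>
  In the two schemas the assignment \<open>s\<close> supplies the parameters. In Replacement, variable 0 of
  \<open>p\<close> is the argument and variable 1 the value.
\<close>

definition separation_schema :: bool where
  "separation_schema \<longleftrightarrow>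
     (\<forall>p s a. \<exists>b. elts b = {x \<in> elts a. sat E p (case_nat x s)})"

definition replacement_schema :: bool where
  "replacement_schema \<longleftrightarrow>
     (\<forall>p s a.
        (\<forall>x\<in>elts a. \<forall>y z. sat E p (case_nat x (case_nat y s)) \<and>
                            sat E p (case_nat x (case_nat z s)) \<longrightarrow> y = z) \<longrightarrow>
        (\<exists>b. elts b = {y. \<exists>x\<in>elts a. sat E p (case_nat x (case_nat y s))}))"

definition ZFC_model :: bool where
  "ZFC_model \<longleftrightarrow>
     extensionality_ax \<and> foundation_ax \<and> pairing_ax \<and> union_ax \<and> power_set_ax \<and>
     infinity_ax \<and> choice_ax \<and> separation_schema \<and> replacement_schema"

definition proper_class :: "'v set \<Rightarrow> bool" where
  "proper_class C \<longleftrightarrow> \<not> (\<exists>a. elts a = C)"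

text \<open>
  The notions below are the usual set-theoretic ones interpreted in the model: every quantifier
  over sets, functions and ordinals ranges over \<open>'v\<close>. Definite descriptions are used for terms
  whose unique existence (for the intended arguments) is a theorem of ZFC.
\<close>

definition vempty :: 'v where
  "vempty = (THE z. elts z = {})"

definition vsucc :: "'v \<Rightarrow> 'v" where
  "vsucc a = (THE z. elts z = insert a (elts a))"

definition upair :: "'v \<Rightarrow> 'v \<Rightarrow> 'v" where
  "upair a b = (THE z. elts z = {a, b})"

definition opair :: "'v \<Rightarrow> 'v \<Rightarrow> 'v" where
  "opair a b = upair (upair a a) (upair a b)"

definition is_fun :: "'v \<Rightarrow> 'v \<Rightarrow> 'v \<Rightarrow> bool" where
  "is_fun f a b \<longleftrightarrow>
     (\<forall>p\<in>elts f. \<exists>x\<in>elts a. \<exists>y\<in>elts b. p = opair x y) \<and>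
     (\<forall>x\<in>elts a. \<exists>!y. opair x y \<in> elts f)"

definition app :: "'v \<Rightarrow> 'v \<Rightarrow> 'v" where
  "app f x = (THE y. opair x y \<in> elts f)"

definition equinumerous :: "'v \<Rightarrow> 'v \<Rightarrow> bool" where
  "equinumerous a b \<longleftrightarrow> (\<exists>f. is_fun f a b \<and> bij_betw (app f) (elts a) (elts b))"

definition ordinal :: "'v \<Rightarrow> bool" where
  "ordinal a \<longleftrightarrow>
     (\<forall>x\<in>elts a. elts x \<subseteq> elts a) \<and>
     (\<forall>x\<in>elts a. \<not> E x x) \<and>
     (\<forall>x\<in>elts a. \<forall>y\<in>elts a. \<forall>z\<in>elts a. E x y \<and> E y z \<longrightarrow> E x z) \<and>
     (\<forall>x\<in>elts a. \<forall>y\<in>elts a. E x y \<or> x = y \<or> E y x) \<and>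
     (\<forall>b. elts b \<subseteq> elts a \<and> elts b \<noteq> {} \<longrightarrow>
          (\<exists>x\<in>elts b. \<forall>y\<in>elts b. x = y \<or> E x y))"

definition ord_le :: "'v \<Rightarrow> 'v \<Rightarrow> bool" where
  "ord_le a b \<longleftrightarrow> E a b \<or> a = b"

definition limit_ordinal :: "'v \<Rightarrow> bool" where
  "limit_ordinal a \<longleftrightarrow> ordinal a \<and> a \<noteq> vempty \<and> (\<forall>x. a \<noteq> vsucc x)"

definition least_ordinal :: "('v \<Rightarrow> bool) \<Rightarrow> 'v" where
  "least_ordinal P = (THE a. ordinal a \<and> P a \<and> (\<forall>b. ordinal b \<and> P b \<longrightarrow> ord_le a b))"

definition omega :: 'v where
  "omega = least_ordinal limit_ordinal"

definition cardinal :: "'v \<Rightarrow> bool" where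
  "cardinal a \<longleftrightarrow> ordinal a \<and> (\<forall>b\<in>elts a. \<not> equinumerous b a)"

definition card_of :: "'v \<Rightarrow> 'v" where
  "card_of a = least_ordinal (\<lambda>b. equinumerous b a)"

definition card_succ :: "'v \<Rightarrow> 'v" where
  "card_succ d = least_ordinal (\<lambda>k. cardinal k \<and> E d k)"

definition omega1 :: 'v where
  "omega1 = card_succ omega"

definition cofinality :: "'v \<Rightarrow> 'v" where
  "cofinality a = least_ordinal
     (\<lambda>b. \<exists>f. is_fun f b a \<and> (\<forall>x\<in>elts a. \<exists>y\<in>elts b. ord_le x (app f y)))"

definition fun_space :: "'v \<Rightarrow> 'v \<Rightarrow> 'v" where
  "fun_space a b = (THE z. elts z = {f. is_fun f a b})"

definition card_exp :: "'v \<Rightarrow> 'v \<Rightarrow> 'v" where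
  "card_exp a b = card_of (fun_space b a)"

text \<open>
  \<open>card_succ_iter d x\<close> is the \<open>x\<close>-th cardinal successor of \<open>d\<close>. It is the last value of the
  sequence \<open>f\<close> of length \<open>x + 1\<close> that starts with \<open>d\<close>, takes the cardinal successor at successor
  steps and the supremum (union) of the earlier values at limit steps.
\<close>

definition card_succ_iter :: "'v \<Rightarrow> 'v \<Rightarrow> 'v" where
  "card_succ_iter d x = (THE k. \<exists>f b.
     is_fun f (vsucc x) b \<and>
     app f vempty = d \<and>
     (\<forall>y. vsucc y \<in> elts (vsucc x) \<longrightarrow> app f (vsucc y) = card_succ (app f y)) \<and>
     (\<forall>y\<in>elts (vsucc x). limit_ordinal y \<longrightarrow>
        elts (app f y) = (\<Union>z\<in>elts y. elts (app f z))) \<and>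
     k = app f x)"

end

end

theory Submission
  imports Defs
begin

text \<open>
  Let \<open>\<kappa>\<close> be any bound and take \<open>\<alpha>\<close> of cofinality \<open>\<omega>\<^sub>1\<close> with \<open>\<alpha>\<^sup>\<omega> > \<alpha> \<ge> \<kappa>\<^sup>\<omega>\<close>. The least \<open>\<delta>\<close> with \<open>\<delta>\<^sup>\<omega> > \<alpha>\<close>
  satisfies \<open>\<kappa> < \<delta>\<close>, and it has cofinality \<open>\<omega>\<close>, since otherwise \<open>\<delta>\<^sup>\<omega>\<close> is the union of the \<open>\<beta>\<^sup>\<omega>\<close>
  for \<open>\<beta> < \<delta>\<close>, hence of size at most \<open>\<alpha>\<close>. So \<open>\<delta> < \<alpha>\<close>. As \<open>\<alpha> > \<omega>\<^sub>1\<close> is singular of cofinality \<open>\<omega>\<^sub>1\<close>, it is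
  neither a successor cardinal nor the limit of fewer than \<open>\<omega>\<^sub>1\<close> cardinals, so it cannot be reached from
  \<open>\<delta>\<close> in fewer than \<open>\<omega>\<^sub>1\<close> cardinal successor steps; thus \<open>\<delta>\<^sup>+\<^sup>\<omega>\<^sup>1 \<le> \<alpha> < \<delta>\<^sup>\<omega>\<close>.

  Separation and Replacement are available in the model only for predicates given by formulas, so every
  set formation carries a definability obligation, discharged syntactically by the rules \<open>definability\<close>.
\<close>

section \<open>Assignments and renaming of variables\<close>

text \<open>Transfinite recursion is needed in three places: to well-order a set, to order
  \<open>k \<times> k\<close> for Hessenberg's theorem, and to list the cardinals from \<delta> to
  \<alpha>. No general recursion theorem is set up; the single lemma \<open>enumeration\<close>,
  with a rank function as parameter, serves all three. In particular the iterated successors are not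
  built from below: an increasing list of the cardinals in the interval is shown to obey the clauses
  of \<open>card_succ_iter\<close>, so that their existence and the bound by \<alpha> come together.

  The bound \<kappa> is also chosen to be at least omega_1. Hence omega_1 < \<delta>, which makes
  every cardinal successor met between \<delta> and \<alpha> have cofinality above omega_1. At the
  end, the \<omega>-th power of \<delta> is a cardinal above the omega_1-th successor of \<delta>,
  hence at least the next cardinal.

  Functions are handled as HOL functions that come with a definability certificate
  (\<open>dterm\<close>); they are turned into sets of the model only where a definition of the
  statement asks for one.\<close>

definition merge :: "(nat \<Rightarrow> 'v) \<Rightarrow> (nat \<Rightarrow> 'v) \<Rightarrow> nat \<Rightarrow> 'v" where
  "merge s e n = (if even n then s (n div 2) else e (n div 2))"

primrec ren :: "(nat \<Rightarrow> nat) \<Rightarrow> fm \<Rightarrow> fm" where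
  "ren r (Mem i j) = Mem (r i) (r j)"
| "ren r (Equal i j) = Equal (r i) (r j)"
| "ren r (Neg p) = Neg (ren r p)"
| "ren r (Conj p q) = Conj (ren r p) (ren r q)"
| "ren r (Forall p) = Forall (ren (case_nat 0 (\<lambda>n. Suc (r n))) p)"

lemma sat_ren: "sat E (ren r p) s = sat E p (\<lambda>n. s (r n))"
proof (induction p arbitrary: r s)
  case (Forall p)
  have "(\<lambda>n. case_nat x s (case_nat 0 (\<lambda>n. Suc (r n)) n)) = case_nat x (\<lambda>n. s (r n))" for x
    by (rule ext) (auto split: nat.split)
  then show ?case by (simp add: Forall)
qed auto

locale zfc =
  fixes E :: "'v \<Rightarrow> 'v \<Rightarrow> bool"
  assumes ZFC: "ZFC_model E"
begin

abbreviation el :: "'v \<Rightarrow> 'v set" where "el \<equiv> elts E"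

lemma E_iff: "E x a \<longleftrightarrow> x \<in> el a"
  by (simp add: elts_def)

section \<open>Definability with parameters\<close>

text \<open>The even variables of the formula carry the arguments, the odd ones the parameters.\<close>

definition definable :: "((nat \<Rightarrow> 'v) \<Rightarrow> bool) \<Rightarrow> bool" where
  "definable P \<longleftrightarrow> (\<exists>p e. \<forall>s. P s = sat E p (merge s e))"

text \<open>The language has no terms beyond variables, so a HOL function enters formulas through
  its graph, with the value in variable 0; \<open>definable_subst\<close> eliminates it by an
  existential quantifier.\<close>

definition dterm :: "((nat \<Rightarrow> 'v) \<Rightarrow> 'v) \<Rightarrow> bool" where
  "dterm t \<longleftrightarrow> definable (\<lambda>s. s 0 = t (\<lambda>n. s (Suc n)))"

named_theorems definability

lemma definable_ren:
  assumes "definable P"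
  shows "definable (\<lambda>s. P (\<lambda>n. s (r n)))"
proof -
  obtain p e where p: "\<And>s. P s = sat E p (merge s e)"
    using assms unfolding definable_def by auto
  have "P (\<lambda>n. s (r n)) = sat E (ren (\<lambda>n. if even n then 2 * r (n div 2) else n) p) (merge s e)" for s
    unfolding sat_ren p
    by (rule arg_cong[of _ _ "sat E p"], rule ext) (simp add: merge_def)
  then show ?thesis unfolding definable_def by blast
qed

lemma definable_not [definability]: "definable P \<Longrightarrow> definable (\<lambda>s. \<not> P s)"
  unfolding definable_def by (elim exE, rule_tac x="Neg p" in exI) auto

text \<open>Each conjunct brings its own parameter assignment. Interleaving the two by
  \<open>merge\<close> keeps both, and the renamings send the odd variables to the right
  half.\<close>

lemma definable_conj [definability]:
  assumes "definable P" "definable Q"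
  shows "definable (\<lambda>s. P s \<and> Q s)"
proof -
  obtain p e where p: "\<And>s. P s = sat E p (merge s e)"
    using assms unfolding definable_def by auto
  obtain q f where q: "\<And>s. Q s = sat E q (merge s f)"
    using assms unfolding definable_def by auto
  let ?r = "\<lambda>n. if even n then n else 2 * (2 * (n div 2)) + 1"
  let ?t = "\<lambda>n. if even n then n else 2 * (2 * (n div 2) + 1) + 1"
  have "(P s \<and> Q s) = sat E (Conj (ren ?r p) (ren ?t q)) (merge s (merge e f))" for s
  proof -
    have "(\<lambda>n. merge s (merge e f) (?r n)) = merge s e" "(\<lambda>n. merge s (merge e f) (?t n)) = merge s f"
      by (rule ext, auto simp: merge_def elim!: oddE)+
    then show ?thesis by (simp add: sat_ren p q)
  qed
  then show ?thesis unfolding definable_def by blast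
qed

lemma definable_all [definability]:
  assumes "definable (\<lambda>s. P (s 0) (\<lambda>n. s (Suc n)))"
  shows "definable (\<lambda>s. \<forall>x. P x s)"
proof -
  obtain p e where p: "\<And>s. P (s 0) (\<lambda>n. s (Suc n)) = sat E p (merge s e)"
    using assms unfolding definable_def by auto
  \<comment> \<open>\<open>Forall\<close> shifts the whole interleaved assignment by one and so
    exchanges the parities of arguments and parameters; the renaming restores them, with the bound
    variable as argument 0.\<close>
  let ?r = "\<lambda>n. if even n then (if n = 0 then 0 else n - 1) else n + 1"
  have "(\<forall>x. P x s) = sat E (Forall (ren ?r p)) (merge s e)" for s
  proof -
    have "(\<lambda>n. case_nat x (merge s e) (?r n)) = merge (case_nat x s) e" for x
    proof
      fix n
      consider "n = 0" | k where "n = Suc (2 * k)" | k where "n = Suc (Suc (2 * k))"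
        by (metis dvd_def not0_implies_Suc odd_Suc_div_two odd_two_times_div_two_succ even_Suc evenE oddE Suc_eq_plus1 add.commute)
      then show "case_nat x (merge s e) (?r n) = merge (case_nat x s) e n"
        by cases (simp_all add: merge_def)
    qed
    then have "sat E (ren ?r p) (case_nat x (merge s e)) = P x s" for x
      using p[of "case_nat x s"] by (simp add: sat_ren)
    then show ?thesis by simp
  qed
  then show ?thesis unfolding definable_def by blast
qed

lemma definable_disj [definability]:
  assumes "definable P" "definable Q"
  shows "definable (\<lambda>s. P s \<or> Q s)"
proof -
  have "definable (\<lambda>s. \<not> (\<not> P s \<and> \<not> Q s))"
    by (intro definable_not definable_conj assms)
  then show ?thesis by simp
qed

lemma definable_imp [definability]:
  assumes "definable P" "definable Q"
  shows "definable (\<lambda>s. P s \<longrightarrow> Q s)"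
proof -
  have "definable (\<lambda>s. \<not> P s \<or> Q s)"
    by (intro definable_not definable_disj assms)
  then show ?thesis by (simp only: imp_conv_disj)
qed

lemma definable_iff [definability]:
  assumes "definable P" "definable Q"
  shows "definable (\<lambda>s. P s = Q s)"
proof -
  have "definable (\<lambda>s. (P s \<longrightarrow> Q s) \<and> (Q s \<longrightarrow> P s))"
    by (intro definable_conj definable_imp assms)
  then show ?thesis by (simp only: iff_conv_conj_imp)
qed

lemma definable_ex [definability]:
  assumes "definable (\<lambda>s. P (s 0) (\<lambda>n. s (Suc n)))"
  shows "definable (\<lambda>s. \<exists>x. P x s)"
  using definable_not[OF definable_all[where P="\<lambda>x s. \<not> P x s", OF definable_not[OF assms]]] by simp

lemma definable_var_eq: "definable (\<lambda>s. s i = s j)"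
  unfolding definable_def
  by (rule exI[of _ "Equal (2*i) (2*j)"]) (simp add: merge_def)

lemma definable_var_eq_const: "definable (\<lambda>s. s i = c)"
  unfolding definable_def
  by (rule exI[of _ "Equal (2*i) 1"], rule exI[of _ "\<lambda>_. c"]) (simp add: merge_def)

lemma definable_var_mem: "definable (\<lambda>s. s i \<in> el (s j))"
  unfolding definable_def
  by (rule exI[of _ "Mem (2*i) (2*j)"]) (simp add: merge_def E_iff)

lemma definable_const [definability]: "definable (\<lambda>s. Q)"
proof -
  have "definable (\<lambda>s. s 0 = s 0)" by (rule definable_var_eq)
  then have "definable (\<lambda>s. True)" by simp
  moreover from definable_not[OF this] have "definable (\<lambda>s. False)" by simp
  ultimately show ?thesis by (cases Q) auto
qed

lemma dterm_var [definability]: "dterm (\<lambda>s. s i)"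
  unfolding dterm_def by (rule definable_var_eq)

lemma dterm_const [definability]: "dterm (\<lambda>s. c)"
  unfolding dterm_def by (rule definable_var_eq_const)

lemma definable_subst:
  assumes "dterm t" "definable (\<lambda>s. P (s 0) (\<lambda>n. s (Suc n)))"
  shows "definable (\<lambda>s. P (t s) s)"
proof -
  have "definable (\<lambda>s. \<exists>x. x = t s \<and> P x s)"
    by (rule definable_ex, rule definable_conj) (use assms dterm_def in auto)
  then show ?thesis by simp
qed

lemma dterm_ren:
  assumes "dterm t"
  shows "dterm (\<lambda>s. t (\<lambda>n. s (r n)))"
  using definable_ren[OF assms[unfolded dterm_def], of "case_nat 0 (\<lambda>n. Suc (r n))"]
  unfolding dterm_def by simp

text \<open>The pattern for new notions: definability is proved for variables only and lifted here
  to arbitrary definable terms, and the lifted form joins the rules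
  \<open>definability\<close>.\<close>

lemma definable_unary:
  assumes "definable (\<lambda>s. P (s 0))" "dterm a"
  shows "definable (\<lambda>s. P (a s))"
  by (rule definable_subst[OF assms(2)]) (rule assms(1))

lemma definable_binary:
  assumes "definable (\<lambda>s. P (s 0) (s 1))" "dterm a" "dterm b"
  shows "definable (\<lambda>s. P (a s) (b s))"
proof (rule definable_subst[OF assms(2), of "\<lambda>x s. P x (b s)"], rule definable_subst[of "\<lambda>s. b (\<lambda>n. s (Suc n))"])
  show "dterm (\<lambda>s. b (\<lambda>n. s (Suc n)))" by (rule dterm_ren) fact
  show "definable (\<lambda>s. P (s (Suc 0)) (s 0))"
    using definable_ren[OF assms(1), of "\<lambda>n. if n = 0 then 1 else 0"] by simp
qed

lemma definable_ternary:
  assumes "definable (\<lambda>s. P (s 0) (s 1) (s 2))" "dterm a" "dterm b" "dterm c"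
  shows "definable (\<lambda>s. P (a s) (b s) (c s))"
proof (rule definable_subst[OF assms(2), of "\<lambda>x s. P x (b s) (c s)"],
    rule definable_subst[of "\<lambda>s. b (\<lambda>n. s (Suc n))" "\<lambda>y s. P (s 0) y (c (\<lambda>n. s (Suc n)))"],
    goal_cases)
  case 1
  show ?case by (rule dterm_ren) fact
next
  case 2
  show ?case
  proof (rule definable_subst[of "\<lambda>s. c (\<lambda>n. s (Suc (Suc n)))"])
    show "dterm (\<lambda>s. c (\<lambda>n. s (Suc (Suc n))))" by (rule dterm_ren) fact
    show "definable (\<lambda>s. P (s (Suc (Suc 0))) (s (Suc 0)) (s 0))"
      using definable_ren[OF assms(1), of "\<lambda>n. 2 - n"] by (simp add: numeral_2_eq_2)
  qed
qed

lemma definable_eq [definability]: "dterm a \<Longrightarrow> dterm b \<Longrightarrow> definable (\<lambda>s. a s = b s)"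
  by (rule definable_binary[where P="(=)", OF definable_var_eq])

lemma definable_mem [definability]:
  assumes "dterm a" "dterm b"
  shows "definable (\<lambda>s. a s \<in> el (b s))"
  using definable_binary[where P="\<lambda>x y. x \<in> el y", OF definable_var_mem assms] .

lemma definable_E [definability]: "dterm a \<Longrightarrow> dterm b \<Longrightarrow> definable (\<lambda>s. E (a s) (b s))"
  using definable_mem[of a b] by (simp add: elts_def)

lemma dterm_graphI:
  assumes "definable (\<lambda>s. P (s 0) (\<lambda>n. s (Suc n)))" "\<And>x s. x = t s \<longleftrightarrow> P x s"
  shows "dterm t"
  unfolding dterm_def assms(2) by (rule assms(1))

lemma dterm_unary:
  assumes "dterm (\<lambda>s. F (s 0))" "dterm a"
  shows "dterm (\<lambda>s. F (a s))"
  unfolding dterm_def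
proof (rule definable_binary[where P="\<lambda>x y. x = F y"])
  show "definable (\<lambda>s. s 0 = F (s 1))" using assms(1) unfolding dterm_def by simp
  show "dterm (\<lambda>s. a (\<lambda>n. s (Suc n)))" by (rule dterm_ren) fact
qed (rule dterm_var)

lemma dterm_binary:
  assumes "dterm (\<lambda>s. F (s 0) (s 1))" "dterm a" "dterm b"
  shows "dterm (\<lambda>s. F (a s) (b s))"
  unfolding dterm_def
proof (rule definable_ternary[where P="\<lambda>x y z. x = F y z"])
  show "definable (\<lambda>s. s 0 = F (s 1) (s 2))" using assms(1) unfolding dterm_def by (simp add: numeral_2_eq_2)
  show "dterm (\<lambda>s. a (\<lambda>n. s (Suc n)))" by (rule dterm_ren) fact
  show "dterm (\<lambda>s. b (\<lambda>n. s (Suc n)))" by (rule dterm_ren) fact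
qed (rule dterm_var)

section \<open>Definability of bounded quantifiers and of HOL set notation\<close>

lemma definable_ball [definability]:
  assumes "definable (\<lambda>s. s 0 \<in> A (\<lambda>n. s (Suc n)))" "definable (\<lambda>s. P (s 0) (\<lambda>n. s (Suc n)))"
  shows "definable (\<lambda>s. \<forall>x\<in>A s. P x s)"
  unfolding Ball_def by (rule definable_all, rule definable_imp) (use assms in auto)

lemma definable_bex [definability]:
  assumes "definable (\<lambda>s. s 0 \<in> A (\<lambda>n. s (Suc n)))" "definable (\<lambda>s. P (s 0) (\<lambda>n. s (Suc n)))"
  shows "definable (\<lambda>s. \<exists>x\<in>A s. P x s)"
  unfolding Bex_def by (rule definable_ex, rule definable_conj) (use assms in auto)

lemma definable_ex1 [definability]:
  assumes "definable (\<lambda>s. P (s 0) (\<lambda>n. s (Suc n)))"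
  shows "definable (\<lambda>s. \<exists>!x. P x s)"
proof -
  have 1: "definable (\<lambda>s. P (s 0) (\<lambda>n. s (Suc (Suc n))))"
    using definable_ren[OF assms, of "case_nat 0 (\<lambda>n. Suc (Suc n))"] by simp
  show ?thesis unfolding Ex1_def by (intro definability 1 assms)
qed

lemma definable_Collect [definability]:
  assumes "dterm t" "definable (\<lambda>s. P (s 0) (\<lambda>n. s (Suc n)))"
  shows "definable (\<lambda>s. t s \<in> {x. P x s})"
  using definable_subst[OF assms] by simp

lemma definable_Int [definability]:
  assumes "definable (\<lambda>s. t s \<in> A s)" "definable (\<lambda>s. t s \<in> B s)"
  shows "definable (\<lambda>s. t s \<in> A s \<inter> B s)"
  using definable_conj[OF assms] by simp

lemma definable_Un [definability]:
  assumes "definable (\<lambda>s. t s \<in> A s)" "definable (\<lambda>s. t s \<in> B s)"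
  shows "definable (\<lambda>s. t s \<in> A s \<union> B s)"
  using definable_disj[OF assms] by simp

lemma definable_Diff [definability]:
  assumes "definable (\<lambda>s. t s \<in> A s)" "definable (\<lambda>s. t s \<in> B s)"
  shows "definable (\<lambda>s. t s \<in> A s - B s)"
  using definable_conj[OF assms(1) definable_not[OF assms(2)]] by simp

lemma definable_insert [definability]:
  assumes "definable (\<lambda>s. t s = a s)" "definable (\<lambda>s. t s \<in> B s)"
  shows "definable (\<lambda>s. t s \<in> insert (a s) (B s))"
  using definable_disj[OF assms] by simp

lemma definable_mem_empty [definability]: "definable (\<lambda>s. t s \<in> {})"
  by (simp add: definable_const)

lemma definable_subset [definability]:
  assumes "definable (\<lambda>s. s 0 \<in> A (\<lambda>n. s (Suc n)))" "definable (\<lambda>s. s 0 \<in> B (\<lambda>n. s (Suc n)))"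
  shows "definable (\<lambda>s. A s \<subseteq> B s)"
  unfolding subset_iff by (intro definability assms)

lemma definable_set_eq [definability]:
  assumes "definable (\<lambda>s. s 0 \<in> A (\<lambda>n. s (Suc n)))" "definable (\<lambda>s. s 0 \<in> B (\<lambda>n. s (Suc n)))"
  shows "definable (\<lambda>s. A s = (B s :: 'v set))"
  unfolding set_eq_iff by (intro definability assms)

lemma definable_image [definability]:
  assumes "dterm t" "definable (\<lambda>s. s 0 \<in> A (\<lambda>n. s (Suc n)))" "dterm (\<lambda>s. F (\<lambda>n. s (Suc n)) (s 0))"
  shows "definable (\<lambda>s. t s \<in> F s ` A s)"
proof -
  have 1: "dterm (\<lambda>s. t (\<lambda>n. s (Suc n)))"
    by (rule dterm_ren) fact
  show ?thesis unfolding image_iff by (intro definable_bex definable_eq assms 1)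
qed

lemma definable_inj_on [definability]:
  assumes "definable (\<lambda>s. s 0 \<in> A (\<lambda>n. s (Suc n)))" "dterm (\<lambda>s. F (\<lambda>n. s (Suc n)) (s 0))"
  shows "definable (\<lambda>s. inj_on (F s) (A s))"
proof -
  have 1: "definable (\<lambda>s. s 0 \<in> A (\<lambda>n. s (Suc (Suc n))))"
    using definable_ren[OF assms(1), of "case_nat 0 (\<lambda>n. Suc (Suc n))"] by simp
  have 2: "dterm (\<lambda>s. F (\<lambda>n. s (Suc (Suc n))) (s 0))"
    using dterm_ren[OF assms(2), of "case_nat 0 (\<lambda>n. Suc (Suc n))"] by simp
  have 3: "dterm (\<lambda>s. F (\<lambda>n. s (Suc (Suc n))) (s (Suc 0)))"
    using dterm_ren[OF assms(2), of "case_nat 1 (\<lambda>n. Suc (Suc n))"] by simp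
  show ?thesis unfolding inj_on_def by (intro definability assms 1 2 3)
qed

lemma definable_bij_betw [definability]:
  assumes "definable (\<lambda>s. s 0 \<in> A (\<lambda>n. s (Suc n)))" "dterm (\<lambda>s. F (\<lambda>n. s (Suc n)) (s 0))"
    "definable (\<lambda>s. s 0 \<in> B (\<lambda>n. s (Suc n)))"
  shows "definable (\<lambda>s. bij_betw (F s) (A s) (B s))"
proof -
  have 1: "definable (\<lambda>s. s 0 \<in> A (\<lambda>n. s (Suc (Suc n))))"
    using definable_ren[OF assms(1), of "case_nat 0 (\<lambda>n. Suc (Suc n))"] by simp
  have 2: "dterm (\<lambda>s. F (\<lambda>n. s (Suc (Suc n))) (s 0))"
    using dterm_ren[OF assms(2), of "case_nat 0 (\<lambda>n. Suc (Suc n))"] by simp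
  show ?thesis unfolding bij_betw_def by (intro definability assms 1 2)
qed

section \<open>Sets of the model\<close>

lemma el_inject [simp]: "el a = el b \<longleftrightarrow> a = b"
  using ZFC by (auto simp: ZFC_model_def extensionality_ax_def)

lemma eqI: "el a = el b \<Longrightarrow> a = b"
  by simp

definition small :: "'v set \<Rightarrow> bool" where
  "small S \<longleftrightarrow> (\<exists>z. el z = S)"

text \<open>The fallback is pinned to the empty set, so the graph has a first-order description even
  for sets not known to be small; this frees \<open>dterm_setof\<close> from a smallness
  premise.\<close>

definition setof :: "'v set \<Rightarrow> 'v" where
  "setof S = (if small S then THE z. el z = S else THE z. el z = {})"

lemma el_setof [simp]: "small S \<Longrightarrow> el (setof S) = S"
  unfolding setof_def small_def by (auto intro: theI2 eqI)

lemma setof_el [simp]: "setof (el a) = a"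
  by (metis el_setof el_inject small_def)

lemma small_el [simp]: "small (el a)"
  unfolding small_def by blast

section \<open>Set existence: Separation, Replacement, pairs, unions, power sets\<close>

lemma small_separation:
  assumes "definable (\<lambda>s. s 0 \<in> S)" "small T" "S \<subseteq> T"
  shows "small S"
proof -
  obtain p e where p: "\<And>s. s 0 \<in> S \<longleftrightarrow> sat E p (merge s e)"
    using assms(1) unfolding definable_def by auto
  obtain a where a: "el a = T" using assms(2) small_def by auto
  \<comment> \<open>All argument variables collapse to variable 0, the one that Separation binds;
    parameter number k moves to variable k + 1.\<close>
  let ?p = "ren (\<lambda>n. if even n then 0 else Suc (n div 2)) p"
  have "sat E ?p (case_nat x e) \<longleftrightarrow> x \<in> S" for x
  proof -
    have "(\<lambda>n. case_nat x e (if even n then 0 else Suc (n div 2))) = merge (\<lambda>_. x) e"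
      by (auto simp: merge_def)
    then show ?thesis using p[of "\<lambda>_. x"] by (simp add: sat_ren)
  qed
  moreover have "\<exists>b. el b = {x \<in> el a. sat E ?p (case_nat x e)}"
    using ZFC unfolding ZFC_model_def separation_schema_def by blast
  ultimately have "\<exists>b. el b = {x \<in> el a. x \<in> S}" by simp
  moreover have "{x \<in> el a. x \<in> S} = S" using assms(3) a by auto
  ultimately show ?thesis by (simp add: small_def)
qed

lemma small_image:
  assumes "dterm (\<lambda>s. F (s 0))" "small S"
  shows "small (F ` S)"
proof -
  have "definable (\<lambda>s. s 1 = F (s 0))"
    by (rule definable_eq[OF dterm_var assms(1)])
  then obtain p e where p: "\<And>s. s 1 = F (s 0) \<longleftrightarrow> sat E p (merge s e)"
    unfolding definable_def by auto
  obtain a where a: "el a = S" using assms(2) small_def by auto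
  \<comment> \<open>Argument 0 stays in place, all other arguments collapse to variable 1, the value
    in Replacement; parameter number k moves to variable k + 2.\<close>
  let ?p = "ren (\<lambda>n. if even n then (if n = 0 then 0 else 1) else Suc (Suc (n div 2))) p"
  have *: "sat E ?p (case_nat x (case_nat y e)) \<longleftrightarrow> y = F x" for x y
  proof -
    have "(\<lambda>n. case_nat x (case_nat y e) (if even n then (if n = 0 then 0 else 1) else Suc (Suc (n div 2))))
        = merge (case_nat x (\<lambda>_. y)) e"
      by (rule ext) (auto simp: merge_def split: nat.split elim!: evenE)
    then show ?thesis using p[of "case_nat x (\<lambda>_. y)"] by (simp add: sat_ren)
  qed
  have "(\<forall>x\<in>el a. \<forall>y z. sat E ?p (case_nat x (case_nat y e)) \<and> sat E ?p (case_nat x (case_nat z e)) \<longrightarrow> y = z) \<longrightarrow>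
        (\<exists>b. el b = {y. \<exists>x\<in>el a. sat E ?p (case_nat x (case_nat y e))})"
    using ZFC unfolding ZFC_model_def replacement_schema_def by blast
  then have "\<exists>b. el b = {y. \<exists>x\<in>el a. y = F x}" unfolding * by blast
  moreover have "{y. \<exists>x\<in>el a. y = F x} = F ` S" using a by auto
  ultimately show ?thesis by (simp add: small_def)
qed

lemma small_pair: "small {a, b}"
  using ZFC unfolding ZFC_model_def pairing_ax_def small_def by blast

lemma small_Union: "small (\<Union>x\<in>el a. el x)"
  using ZFC unfolding ZFC_model_def union_ax_def small_def by blast

lemma small_UN:
  assumes "dterm (\<lambda>s. F (s 0))" "small A"
  shows "small (\<Union>x\<in>A. el (F x))"
  using small_image[OF assms] small_Union[of "setof (F ` A)"] by simp

lemma small_Un [simp]: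
  assumes "small A" "small B"
  shows "small (A \<union> B)"
proof -
  obtain a b where "el a = A" "el b = B" using assms small_def by auto
  then show ?thesis using small_Union[of "setof {a, b}"] by (simp add: small_pair)
qed

lemma small_empty [simp]: "small {}"
  by (rule small_separation[of _ "el undefined"]) (auto intro: definability)

lemma small_insert [simp]: "small A \<Longrightarrow> small (insert a A)"
  using small_Un[of "{a}" A] small_pair[of a a] by simp

lemma small_Pow: "small {x. el x \<subseteq> el a}"
  using ZFC unfolding ZFC_model_def power_set_ax_def small_def by blast

lemma small_Diff [simp]:
  assumes "small A"
  shows "small (A - el b)"
proof -
  obtain a where a: "A = el a" using assms small_def by auto
  show ?thesis
    by (rule small_separation[of _ A], unfold a, intro definability) auto
qed

lemma dterm_setof [definability]:
  assumes "definable (\<lambda>s. s 0 \<in> S (\<lambda>n. s (Suc n)))"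
  shows "dterm (\<lambda>s. setof (S s))"
proof (rule dterm_graphI[where P="\<lambda>y s. el y = S s \<or> (\<not> (\<exists>z. el z = S s) \<and> el y = {})"])
  have 1: "definable (\<lambda>s. s 0 \<in> S (\<lambda>n. s (Suc (Suc n))))"
    using definable_ren[OF assms, of "case_nat 0 (\<lambda>n. Suc (Suc n))"] by simp
  have 2: "definable (\<lambda>s. s 0 \<in> S (\<lambda>n. s (Suc (Suc (Suc n)))))"
    using definable_ren[OF assms, of "case_nat 0 (\<lambda>n. Suc (Suc (Suc n)))"] by simp
  show "definable (\<lambda>s. el (s 0) = S (\<lambda>n. s (Suc n)) \<or> (\<not> (\<exists>z. el z = S (\<lambda>n. s (Suc n))) \<and> el (s 0) = {}))"
    by (intro definability 1 2)
  show "x = setof (S s) \<longleftrightarrow> el x = S s \<or> (\<not> (\<exists>z. el z = S s) \<and> el x = {})" for x s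
  proof (cases "small (S s)")
    case True
    then have "x = setof (S s) \<longleftrightarrow> el x = S s" by (metis el_setof el_inject)
    with True show ?thesis by (auto simp: small_def)
  next
    case False
    then have "setof (S s) = setof {}" by (simp add: setof_def)
    then have "x = setof (S s) \<longleftrightarrow> el x = {}" by (metis el_setof el_inject small_empty)
    with False show ?thesis by (auto simp: small_def)
  qed
qed

section \<open>The basic operations of the statement: pairs, functions, products\<close>

lemma the_el: "small S \<Longrightarrow> (THE z. el z = S) = setof S"
  by (simp add: setof_def)

lemma vempty_setof: "vempty E = setof {}" unfolding vempty_def by (rule the_el) simp
lemma vsucc_setof: "vsucc E a = setof (insert a (el a))" unfolding vsucc_def by (rule the_el) simp
lemma upair_setof: "upair E a b = setof {a, b}" unfolding upair_def by (rule the_el) simp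

lemma el_vempty [simp]: "el (vempty E) = {}" by (simp add: vempty_setof)
lemma el_vsucc [simp]: "el (vsucc E a) = insert a (el a)" by (simp add: vsucc_setof)
lemma el_upair [simp]: "el (upair E a b) = {a, b}" by (simp add: upair_setof)

lemma dterm_vsucc: "dterm (\<lambda>s. vsucc E (s 0))" unfolding vsucc_setof by (intro definability)
lemma dterm_upair: "dterm (\<lambda>s. upair E (s 0) (s 1))" unfolding upair_setof by (intro definability)
lemmas [definability] = dterm_unary[OF dterm_vsucc] dterm_binary[OF dterm_upair]

lemma dterm_opair: "dterm (\<lambda>s. opair E (s 0) (s 1))" unfolding opair_def by (intro definability)
lemmas [definability] = dterm_binary[OF dterm_opair]

lemma upair_eq_iff: "upair E a b = upair E c d \<longleftrightarrow> {a, b} = {c, d}"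
  by (metis eqI el_upair)

lemma opair_eq_iff [simp]: "opair E a b = opair E c d \<longleftrightarrow> a = c \<and> b = d"
  unfolding opair_def upair_eq_iff by (auto simp: doubleton_eq_iff upair_eq_iff)

text \<open>\<open>app\<close> is a definite description without a specified value off the domain,
  so its graph cannot be shown definable. Taking the union of all values gives a definable
  substitute that agrees with \<open>app\<close> on functions. The same device, the union of all y
  with a property that only one y has, serves below as a definable description operator.\<close>

definition ap :: "'v \<Rightarrow> 'v \<Rightarrow> 'v" where
  "ap f x = setof {z. \<exists>y. opair E x y \<in> el f \<and> z \<in> el y}"

lemma dterm_ap: "dterm (\<lambda>s. ap (s 0) (s 1))" unfolding ap_def by (intro definability)
lemmas [definability] = dterm_binary[OF dterm_ap]

definition lam :: "'v \<Rightarrow> ('v \<Rightarrow> 'v) \<Rightarrow> 'v" where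
  "lam a F = setof ((\<lambda>x. opair E x (F x)) ` el a)"

lemma el_lam:
  assumes "dterm (\<lambda>s. F (s 0))"
  shows "el (lam a F) = (\<lambda>x. opair E x (F x)) ` el a"
  unfolding lam_def by (intro el_setof small_image definability assms small_el)

lemma dterm_lam [definability]:
  assumes "dterm a" "dterm (\<lambda>s. F (s 0) (\<lambda>n. s (Suc n)))"
  shows "dterm (\<lambda>s. lam (a s) (\<lambda>x. F x s))"
proof -
  have 1: "dterm (\<lambda>s. a (\<lambda>n. s (Suc (Suc n))))" by (rule dterm_ren) fact
  have 2: "dterm (\<lambda>s. F (s 0) (\<lambda>n. s (Suc (Suc n))))"
    using dterm_ren[OF assms(2), of "case_nat 0 (\<lambda>n. Suc (Suc n))"] by simp
  show ?thesis unfolding lam_def by (intro definability 1 2)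
qed

lemma ap_eqI:
  assumes "opair E x y \<in> el f" "\<And>z. opair E x z \<in> el f \<Longrightarrow> z = y"
  shows "ap f x = y"
proof -
  have "{z. \<exists>y. opair E x y \<in> el f \<and> z \<in> el y} = el y" using assms by blast
  then show ?thesis by (simp add: ap_def)
qed

lemma ap_lam [simp]:
  "dterm (\<lambda>s. F (s 0)) \<Longrightarrow> x \<in> el a \<Longrightarrow> ap (lam a F) x = F x"
  by (rule ap_eqI) (auto simp: el_lam)

lemma app_eq_ap: "is_fun E f a b \<Longrightarrow> x \<in> el a \<Longrightarrow> app E f x = ap f x"
  unfolding is_fun_def app_def
  by (metis (mono_tags, lifting) ap_eqI the1_equality)

lemma is_fun_ap_mem: "is_fun E f a b \<Longrightarrow> x \<in> el a \<Longrightarrow> ap f x \<in> el b"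
  unfolding is_fun_def by (metis ap_eqI opair_eq_iff)

lemma is_fun_lam:
  "dterm (\<lambda>s. F (s 0)) \<Longrightarrow> F ` el a \<subseteq> el b \<Longrightarrow> is_fun E (lam a F) a b"
  unfolding is_fun_def by (auto simp: el_lam)

lemma is_fun_elt_iff: "is_fun E f a b \<Longrightarrow> p \<in> el f \<longleftrightarrow> (\<exists>x\<in>el a. p = opair E x (ap f x))"
  unfolding is_fun_def by (metis ap_eqI)

lemma is_fun_ext:
  assumes "is_fun E f a b" "is_fun E g a c" "\<And>x. x \<in> el a \<Longrightarrow> ap f x = ap g x"
  shows "f = g"
proof -
  have "p \<in> el f \<longleftrightarrow> p \<in> el g" for p
    unfolding is_fun_elt_iff[OF assms(1)] is_fun_elt_iff[OF assms(2)]
    by (rule bex_cong[OF refl]) (simp add: assms(3))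
  then show ?thesis by (intro eqI set_eqI)
qed

lemma definable_is_fun: "definable (\<lambda>s. is_fun E (s 0) (s 1) (s 2))"
  unfolding is_fun_def by (intro definability)
lemmas [definability] = definable_ternary[OF definable_is_fun]

definition prod_set :: "'v \<Rightarrow> 'v \<Rightarrow> 'v" where
  "prod_set a b = setof {p. \<exists>x\<in>el a. \<exists>y\<in>el b. p = opair E x y}"

lemma el_prod_set [simp]: "el (prod_set a b) = {p. \<exists>x\<in>el a. \<exists>y\<in>el b. p = opair E x y}"
proof -
  let ?F = "\<lambda>x. setof {p. \<exists>y\<in>el b. p = opair E x y}"
  have s: "small {p. \<exists>y\<in>el b. p = opair E x y}" for x
  proof -
    have "small ((\<lambda>y. opair E x y) ` el b)"
      by (rule small_image) (intro definability, simp)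
    moreover have "{p. \<exists>y\<in>el b. p = opair E x y} = (\<lambda>y. opair E x y) ` el b" by auto
    ultimately show ?thesis by simp
  qed
  have "small (\<Union>x\<in>el a. el (?F x))"
    by (rule small_UN) (intro definability, simp)
  moreover have "(\<Union>x\<in>el a. el (?F x)) = {p. \<exists>x\<in>el a. \<exists>y\<in>el b. p = opair E x y}"
    by (auto simp: s)
  ultimately show ?thesis unfolding prod_set_def by simp
qed

lemma dterm_prod_set: "dterm (\<lambda>s. prod_set (s 0) (s 1))" unfolding prod_set_def by (intro definability)
lemmas [definability] = dterm_binary[OF dterm_prod_set]

definition pfst :: "'v \<Rightarrow> 'v" where
  "pfst p = setof {z. \<exists>x y. p = opair E x y \<and> z \<in> el x}"

definition psnd :: "'v \<Rightarrow> 'v" where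
  "psnd p = setof {z. \<exists>x y. p = opair E x y \<and> z \<in> el y}"

lemma pfst_opair [simp]: "pfst (opair E x y) = x" by (simp add: pfst_def)
lemma psnd_opair [simp]: "psnd (opair E x y) = y" by (simp add: psnd_def)
lemma dterm_pfst: "dterm (\<lambda>s. pfst (s 0))" unfolding pfst_def by (intro definability)
lemma dterm_psnd: "dterm (\<lambda>s. psnd (s 0))" unfolding psnd_def by (intro definability)
lemmas [definability] = dterm_unary[OF dterm_pfst] dterm_unary[OF dterm_psnd]

definition power_set :: "'v \<Rightarrow> 'v" where "power_set a = setof {x. el x \<subseteq> el a}"
lemma el_power_set [simp]: "el (power_set a) = {x. el x \<subseteq> el a}" unfolding power_set_def by (simp add: small_Pow)

lemma small_funs: "small {f. is_fun E f a b}"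
proof (rule small_separation)
  show "{f. is_fun E f a b} \<subseteq> el (power_set (prod_set a b))"
    unfolding is_fun_def by auto
  show "definable (\<lambda>s. s 0 \<in> {f. is_fun E f a b})" by (intro definability)
  show "small (el (power_set (prod_set a b)))" by (rule small_el)
qed

lemma fun_space_setof: "fun_space E a b = setof {f. is_fun E f a b}"
  unfolding fun_space_def by (rule the_el) (rule small_funs)

lemma el_fun_space [simp]: "el (fun_space E a b) = {f. is_fun E f a b}"
  by (simp add: fun_space_setof small_funs)

lemma dterm_fun_space: "dterm (\<lambda>s. fun_space E (s 0) (s 1))"
  unfolding fun_space_setof by (intro definability)
lemmas [definability] = dterm_binary[OF dterm_fun_space]

section \<open>Ordinals\<close>

abbreviation Ord :: "'v \<Rightarrow> bool" where "Ord \<equiv> ordinal E"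

lemma foundation: "small S \<Longrightarrow> S \<noteq> {} \<Longrightarrow> \<exists>x\<in>S. el x \<inter> S = {}"
  using ZFC unfolding ZFC_model_def foundation_ax_def small_def by blast

lemma not_mem_self [simp]: "x \<notin> el x"
  using foundation[of "{x}"] by auto

lemma not_mem_cycle2: "x \<in> el y \<Longrightarrow> y \<notin> el x"
  using foundation[of "{x, y}"] by auto

lemma not_mem_cycle3: "x \<in> el y \<Longrightarrow> y \<in> el z \<Longrightarrow> z \<notin> el x"
  using foundation[of "{x, y, z}"] by auto

text \<open>Foundation excludes membership cycles of length up to three, which with linearity yields
  irreflexivity and transitivity of membership, and it supplies the least elements.\<close>

lemma Ord_iff:
  "Ord a \<longleftrightarrow> (\<forall>x\<in>el a. el x \<subseteq> el a) \<and> (\<forall>x\<in>el a. \<forall>y\<in>el a. x \<in> el y \<or> x = y \<or> y \<in> el x)"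
  (is "_ \<longleftrightarrow> ?t \<and> ?l")
proof -
  have E_mem: "E x y \<longleftrightarrow> x \<in> el y" for x y by (simp add: elts_def)
  show ?thesis
  proof
    assume "Ord a"
    note o = this[unfolded ordinal_def]
    from o have t: ?t by (elim conjE)
    from o have "\<forall>x\<in>el a. \<forall>y\<in>el a. E x y \<or> x = y \<or> E y x" by (elim conjE)
    with t show "?t \<and> ?l" unfolding elts_def mem_Collect_eq by (intro conjI)
  next
    assume "?t \<and> ?l"
    then have t: ?t and l: ?l by blast+
    have 1: "\<exists>x\<in>el b. \<forall>y\<in>el b. x = y \<or> E x y" if b: "el b \<subseteq> el a" "el b \<noteq> {}" for b
    proof -
      obtain x where "x \<in> el b" "el x \<inter> el b = {}" using foundation[OF small_el b(2)] by blast
      then have "x = y \<or> E x y" if "y \<in> el b" for y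
        unfolding E_mem[of x y] using l b that by blast
      then show ?thesis using \<open>x \<in> el b\<close> by blast
    qed
    have 2: "E x z" if "x \<in> el a" "y \<in> el a" "z \<in> el a" "E x y" "E y z" for x y z
      using l that not_mem_cycle3[of x y z] not_mem_cycle2[of x y]
      unfolding E_mem[of x y] E_mem[of y z] E_mem[of x z] by blast
    have 3: "E x y \<or> x = y \<or> E y x" if "x \<in> el a" "y \<in> el a" for x y
      using l that unfolding E_mem[of x y] E_mem[of y x] by blast
    have 4: "\<not> E x x" for x unfolding E_mem[of x x] by (rule not_mem_self)
    show "Ord a" unfolding ordinal_def using t 1 2 3 4 by (intro conjI) blast+
  qed
qed

lemma definable_Ord: "definable (\<lambda>s. Ord (s 0))"
  unfolding Ord_iff by (intro definability)
lemmas [definability] = definable_unary[OF definable_Ord]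

lemma Ord_mem_subset: "Ord a \<Longrightarrow> x \<in> el a \<Longrightarrow> el x \<subseteq> el a"
  unfolding Ord_iff by blast

lemma Ord_mem:
  assumes "Ord a" "x \<in> el a"
  shows "Ord x"
  unfolding Ord_iff
proof (intro conjI ballI subsetI)
  show "z \<in> el x" if "y \<in> el x" "z \<in> el y" for y z
  proof -
    have "y \<in> el a" "z \<in> el a" using that assms Ord_mem_subset by blast+
    then show ?thesis using that assms not_mem_cycle3[of z y x] not_mem_cycle2[of z y]
      unfolding Ord_iff by blast
  qed
  show "y \<in> el z \<or> y = z \<or> z \<in> el y" if "y \<in> el x" "z \<in> el x" for y z
    using that assms unfolding Ord_iff by blast
qed

text \<open>A membership-minimal element of \<open>el b - el a\<close> has exactly the elements of
  \<open>a\<close>, hence is \<open>a\<close>.\<close>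

lemma Ord_psubset:
  assumes "Ord a" "Ord b" "el a \<subset> el b"
  shows "a \<in> el b"
proof -
  obtain x where x: "x \<in> el b - el a" "el x \<inter> (el b - el a) = {}"
    using foundation[of "el b - el a"] assms by auto
  have "el x \<subseteq> el a" using x Ord_mem_subset[OF assms(2), of x] by blast
  moreover have "el a \<subseteq> el x"
  proof
    fix y assume y: "y \<in> el a"
    then have "y \<in> el x \<or> y = x \<or> x \<in> el y" using x assms unfolding Ord_iff by blast
    then show "y \<in> el x" using y x Ord_mem_subset[OF assms(1)] by blast
  qed
  ultimately have "el x = el a" by simp
  then show ?thesis using x by simp
qed

lemma Ord_Int: "Ord a \<Longrightarrow> Ord b \<Longrightarrow> Ord (setof (el a \<inter> el b))"
proof -
  have "small (el a \<inter> el b)"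
    by (rule small_separation[of _ "el a"]) (auto intro!: definability)
  then show "Ord a \<Longrightarrow> Ord b \<Longrightarrow> Ord (setof (el a \<inter> el b))"
    unfolding Ord_iff by auto
qed

text \<open>The intersection is an ordinal; were it proper in both, it would be an element of both
  and therefore of itself.\<close>

lemma Ord_subset_linear:
  assumes "Ord a" "Ord b"
  shows "el a \<subseteq> el b \<or> el b \<subseteq> el a"
proof (rule ccontr)
  assume n: "\<not> ?thesis"
  have s: "small (el a \<inter> el b)"
    by (rule small_separation[of _ "el a"]) (auto intro!: definability)
  let ?c = "setof (el a \<inter> el b)"
  have "?c \<in> el a" "?c \<in> el b"
    using n Ord_psubset[OF Ord_Int[OF assms]] assms s by auto
  then have "?c \<in> el ?c" using s by simp
  then show False by (simp only: not_mem_self)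
qed

lemma Ord_not_mem:
  assumes "Ord a" "Ord b"
  shows "a \<notin> el b \<longleftrightarrow> el b \<subseteq> el a"
proof
  assume "a \<notin> el b"
  then show "el b \<subseteq> el a"
    using Ord_subset_linear[OF assms] Ord_psubset[OF assms] by blast
next
  assume "el b \<subseteq> el a"
  then show "a \<notin> el b" using not_mem_self by blast
qed

lemma Ord_linear: "Ord a \<Longrightarrow> Ord b \<Longrightarrow> a \<in> el b \<or> a = b \<or> b \<in> el a"
  using Ord_subset_linear Ord_psubset by (metis el_inject psubsetI)

lemma ord_le_iff: "Ord a \<Longrightarrow> Ord b \<Longrightarrow> ord_le E a b \<longleftrightarrow> el a \<subseteq> el b"
  unfolding ord_le_def elts_def[symmetric]
  by (metis Ord_mem_subset Ord_not_mem Ord_linear elts_def mem_Collect_eq order_refl not_mem_cycle2)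

lemma Ord_mem_trans: "Ord c \<Longrightarrow> a \<in> el b \<Longrightarrow> b \<in> el c \<Longrightarrow> a \<in> el c"
  using Ord_mem_subset by blast

lemma Ord_vempty [simp]: "Ord (vempty E)"
  by (simp add: Ord_iff)

lemma Ord_vsucc: "Ord a \<Longrightarrow> Ord (vsucc E a)"
  unfolding Ord_iff by auto

lemma Ord_trans_of_Ords:
  assumes "\<And>x. x \<in> el a \<Longrightarrow> Ord x" "\<And>x. x \<in> el a \<Longrightarrow> el x \<subseteq> el a"
  shows "Ord a"
  unfolding Ord_iff using assms Ord_linear by blast

lemma Ord_Union:
  assumes "\<And>x. x \<in> el a \<Longrightarrow> Ord x"
  shows "Ord (setof (\<Union>x\<in>el a. el x))"
proof (rule Ord_trans_of_Ords)
  show "Ord x" if "x \<in> el (setof (\<Union>x\<in>el a. el x))" for x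
    using that small_Union[of a] assms Ord_mem by auto
  show "el x \<subseteq> el (setof (\<Union>x\<in>el a. el x))" if "x \<in> el (setof (\<Union>x\<in>el a. el x))" for x
    using that small_Union[of a] assms Ord_mem_subset[OF assms] by (simp add: UN_iff) blast
qed

lemma Ord_least:
  assumes "definable (\<lambda>s. P (s 0))" "Ord a" "P a"
  obtains m where "Ord m" "P m" "el m \<subseteq> el a" "\<And>b. b \<in> el m \<Longrightarrow> \<not> P b"
    "\<And>b. Ord b \<Longrightarrow> P b \<Longrightarrow> el m \<subseteq> el b"
proof -
  \<comment> \<open>Foundation needs a nonempty set: the class is cut off at the successor of
    \<open>a\<close>, so that \<open>a\<close> itself still belongs to it.\<close>
  let ?S = "{x \<in> el (vsucc E a). P x}"
  have "small ?S"
    by (rule small_separation[of _ "el (vsucc E a)"], intro definability assms(1)) auto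
  moreover have "?S \<noteq> {}" using assms by auto
  ultimately obtain m where m: "m \<in> ?S" "el m \<inter> ?S = {}" using foundation by blast
  have o: "Ord m" using m Ord_vsucc[OF assms(2)] Ord_mem by blast
  have le: "el m \<subseteq> el a" using m Ord_mem_subset[OF assms(2)] by auto
  have n: "\<not> P b" if "b \<in> el m" for b using m le that by auto
  show ?thesis
  proof (rule that[OF o _ le n])
    show "P m" using m by simp
    show "el m \<subseteq> el b" if "Ord b" "P b" for b
      using n that Ord_not_mem[OF that(1) o] by blast
  qed
qed

lemma Ord_induct:
  assumes "definable (\<lambda>s. P (s 0))" "Ord a"
    "\<And>x. Ord x \<Longrightarrow> (\<And>y. y \<in> el x \<Longrightarrow> P y) \<Longrightarrow> P x"
  shows "P a"
proof (rule ccontr)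
  assume "\<not> P a"
  with definable_not[OF assms(1)] assms(2) obtain m where "Ord m" "\<not> P m" "\<And>b. b \<in> el m \<Longrightarrow> \<not> \<not> P b"
    by (rule Ord_least[where P="\<lambda>x. \<not> P x"]) auto
  then show False using assms(3) by blast
qed

lemma least_ordinal_eq:
  assumes "Ord a" "P a" "\<And>b. b \<in> el a \<Longrightarrow> \<not> P b"
  shows "least_ordinal E P = a"
  unfolding least_ordinal_def
proof (rule the_equality)
  have "ord_le E a b" if "Ord b" "P b" for b
    using that assms(3) Ord_not_mem[OF that(1) assms(1)] ord_le_iff[OF assms(1) that(1)] by blast
  then show "Ord a \<and> P a \<and> (\<forall>b. Ord b \<and> P b \<longrightarrow> ord_le E a b)" using assms by simp
  then show "b = a" if "Ord b \<and> P b \<and> (\<forall>c. Ord c \<and> P c \<longrightarrow> ord_le E b c)" for b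
    using that ord_le_iff[of a b] ord_le_iff[of b a] by (metis el_inject subset_antisym)
qed

lemma least_ordinal_props:
  assumes "definable (\<lambda>s. P (s 0))" "Ord a" "P a"
  shows "Ord (least_ordinal E P)" "P (least_ordinal E P)"
    "\<And>b. b \<in> el (least_ordinal E P) \<Longrightarrow> \<not> P b" "\<And>b. Ord b \<Longrightarrow> P b \<Longrightarrow> el (least_ordinal E P) \<subseteq> el b"
proof -
  obtain m where m: "Ord m" "P m" "\<And>b. b \<in> el m \<Longrightarrow> \<not> P b" "\<And>b. Ord b \<Longrightarrow> P b \<Longrightarrow> el m \<subseteq> el b"
    using Ord_least[of P, OF assms] by metis
  then have "least_ordinal E P = m" by (intro least_ordinal_eq)
  then show "Ord (least_ordinal E P)" "P (least_ordinal E P)"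
    "\<And>b. b \<in> el (least_ordinal E P) \<Longrightarrow> \<not> P b" "\<And>b. Ord b \<Longrightarrow> P b \<Longrightarrow> el (least_ordinal E P) \<subseteq> el b"
    using m by auto
qed

text \<open>Burali-Forti: such a set would be an ordinal and thus its own element.\<close>

lemma not_small_Ord: "\<not> small {x. Ord x}"
proof
  assume s: "small {x. Ord x}"
  have "Ord (setof {x. Ord x})"
    by (rule Ord_trans_of_Ords) (use s Ord_mem in auto)
  then have "setof {x. Ord x} \<in> el (setof {x. Ord x})" using s by simp
  then show False by (simp only: not_mem_self)
qed

lemma limit_ordinal_iff:
  assumes "Ord a"
  shows "limit_ordinal E a \<longleftrightarrow> el a \<noteq> {} \<and> (\<forall>x\<in>el a. vsucc E x \<in> el a)"
proof
  assume l: "limit_ordinal E a"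
  have "el a \<noteq> {}" using l unfolding limit_ordinal_def by (metis el_inject el_vempty)
  moreover have "vsucc E x \<in> el a" if "x \<in> el a" for x
  proof (rule ccontr)
    assume "vsucc E x \<notin> el a"
    then have "el a \<subseteq> el (vsucc E x)"
      using Ord_not_mem Ord_vsucc Ord_mem assms that by blast
    moreover have "el (vsucc E x) \<subseteq> el a" using that Ord_mem_subset[OF assms that] by auto
    ultimately have "a = vsucc E x" by (metis el_inject subset_antisym)
    then show False using l unfolding limit_ordinal_def by blast
  qed
  ultimately show "el a \<noteq> {} \<and> (\<forall>x\<in>el a. vsucc E x \<in> el a)" by blast
next
  assume r: "el a \<noteq> {} \<and> (\<forall>x\<in>el a. vsucc E x \<in> el a)"
  have "a \<noteq> vsucc E x" for x
    using r not_mem_self[of "vsucc E x"] by (metis el_vsucc insertI1)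
  then show "limit_ordinal E a" unfolding limit_ordinal_def using assms r by auto
qed

lemma definable_limit: "definable (\<lambda>s. limit_ordinal E (s 0))"
  unfolding limit_ordinal_def by (intro definability)
lemmas [definability] = definable_unary[OF definable_limit]

lemma Ord_cases:
  assumes "Ord a"
  obtains "a = vempty E" | x where "Ord x" "a = vsucc E x" | "limit_ordinal E a"
  using assms Ord_mem[OF assms] unfolding limit_ordinal_def by (metis el_vsucc insertI1)

section \<open>The ordinal \<omega>\<close>

abbreviation om :: 'v where "om \<equiv> omega E"

text \<open>Without limits, induction along zero and successors would place every ordinal in the
  inductive set given by Infinity, against Burali-Forti.\<close>

lemma ex_limit: "\<exists>a. limit_ordinal E a"
proof (rule ccontr)
  assume n: "\<not> ?thesis"
  obtain w where w: "\<exists>e\<in>el w. el e = {}" "\<And>x. x \<in> el w \<Longrightarrow> \<exists>y\<in>el w. el y = insert x (el x)"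
    using ZFC unfolding ZFC_model_def infinity_ax_def by blast
  have "a \<in> el w" if "Ord a" for a
  proof (rule Ord_induct[OF _ that])
    show "definable (\<lambda>s. s 0 \<in> el w)" by (intro definability)
    fix x assume x: "Ord x" "\<And>y. y \<in> el x \<Longrightarrow> y \<in> el w"
    from x(1) show "x \<in> el w"
    proof (cases rule: Ord_cases)
      case 1
      then show ?thesis using w(1) by (metis el_inject el_vempty)
    next
      case (2 y)
      then show ?thesis using w(2)[of y] x(2)[of y] by (metis el_inject el_vsucc insertI1)
    qed (use n in auto)
  qed
  then have "{x. Ord x} \<subseteq> el w" by blast
  with small_el have "small {x. Ord x}"
    by (rule small_separation[rotated]) (intro definability)
  then show False by (simp add: not_small_Ord)
qed

lemma limit_om: "limit_ordinal E om"
  and om_least: "\<And>b. b \<in> el om \<Longrightarrow> \<not> limit_ordinal E b"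
proof -
  obtain a where a: "limit_ordinal E a" using ex_limit by blast
  then have "Ord a" by (simp add: limit_ordinal_def)
  note * = least_ordinal_props[OF definable_limit this a]
  show "limit_ordinal E om" unfolding omega_def by (rule *)
  show "\<And>b. b \<in> el om \<Longrightarrow> \<not> limit_ordinal E b" unfolding omega_def by (rule *)
qed

lemma Ord_om [simp]: "Ord om" using limit_om by (simp add: limit_ordinal_def)

lemma vsucc_om: "x \<in> el om \<Longrightarrow> vsucc E x \<in> el om"
  using limit_om limit_ordinal_iff by auto

lemma vempty_om [simp]: "vempty E \<in> el om"
  using limit_om limit_ordinal_iff[OF Ord_om] Ord_psubset[of "vempty E" om] by auto

lemma om_induct:
  assumes "definable (\<lambda>s. P (s 0))" "n \<in> el om" "P (vempty E)"
    "\<And>x. x \<in> el om \<Longrightarrow> P x \<Longrightarrow> P (vsucc E x)"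
  shows "P n"
proof -
  have "n \<in> el om \<longrightarrow> P n"
  proof (rule Ord_induct[where P="\<lambda>n. n \<in> el om \<longrightarrow> P n"])
    show "definable (\<lambda>s. s 0 \<in> el om \<longrightarrow> P (s 0))" by (intro definability assms(1))
    show "Ord n" using Ord_mem[OF Ord_om assms(2)] .
    fix x assume x: "Ord x" "\<And>y. y \<in> el x \<Longrightarrow> y \<in> el om \<longrightarrow> P y"
    from x(1) show "x \<in> el om \<longrightarrow> P x"
    proof (cases rule: Ord_cases)
      case (2 y)
      then show ?thesis using x(2)[of y] assms(4)[of y] Ord_mem_trans[OF Ord_om, of y x] by auto
    qed (use assms om_least in auto)
  qed
  then show ?thesis using assms by blast
qed

lemma vsucc_mem_vsucc:
  assumes "Ord a"
  shows "vsucc E x \<in> el (vsucc E a) \<longleftrightarrow> x \<in> el a"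
proof
  assume x: "x \<in> el a"
  have o: "Ord (vsucc E x)" "Ord (vsucc E a)"
    using Ord_vsucc assms Ord_mem[OF assms x] by blast+
  show "vsucc E x \<in> el (vsucc E a)"
  proof (rule ccontr)
    assume "vsucc E x \<notin> el (vsucc E a)"
    then have "a \<in> el (vsucc E x)" unfolding Ord_not_mem[OF o] by auto
    then show False using x not_mem_cycle2[OF x] not_mem_self by auto
  qed
next
  assume "vsucc E x \<in> el (vsucc E a)"
  then have "vsucc E x = a \<or> vsucc E x \<in> el a" by auto
  then show "x \<in> el a" using Ord_mem_subset[OF assms, of "vsucc E x"] by auto
qed

section \<open>Comparison of size\<close>

lemma dterm_if [definability]:
  assumes "definable P" "dterm t" "dterm u"
  shows "dterm (\<lambda>s. if P s then t s else u s)"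
proof -
  have 1: "definable (\<lambda>s. P (\<lambda>n. s (Suc (Suc n))))" by (rule definable_ren) fact
  have 2: "dterm (\<lambda>s. t (\<lambda>n. s (Suc (Suc n))))" by (rule dterm_ren) fact
  have 3: "dterm (\<lambda>s. u (\<lambda>n. s (Suc (Suc n))))" by (rule dterm_ren) fact
  have "dterm (\<lambda>s. setof {z. (P s \<and> z \<in> el (t s)) \<or> (\<not> P s \<and> z \<in> el (u s))})"
    by (intro definability 1 2 3)
  moreover have "setof {z. (P s \<and> z \<in> el (t s)) \<or> (\<not> P s \<and> z \<in> el (u s))} = (if P s then t s else u s)" for s
    by simp
  ultimately show ?thesis by simp
qed

definition dinv :: "('v \<Rightarrow> 'v) \<Rightarrow> 'v \<Rightarrow> 'v \<Rightarrow> 'v" where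
  "dinv F a y = setof {z. \<exists>x\<in>el a. F x = y \<and> z \<in> el x}"

lemma dterm_dinv:
  assumes "dterm (\<lambda>s. F (s 0))"
  shows "dterm (\<lambda>s. dinv F a (s 0))"
  unfolding dinv_def by (intro definability dterm_unary[OF assms])

lemma dinv_eq [simp]:
  assumes "inj_on F (el a)" "x \<in> el a"
  shows "dinv F a (F x) = x"
proof -
  have "{z. \<exists>x'\<in>el a. F x' = F x \<and> z \<in> el x'} = el x"
    using assms by (auto dest: inj_onD)
  then show ?thesis by (simp add: dinv_def)
qed

text \<open>Since \<open>ap\<close> is total, any set may act as \<open>f\<close>, which keeps the
  formula short. \<open>lepollI\<close> and \<open>lepollE\<close> translate between such codes and
  definable HOL functions.\<close>

definition lepoll :: "'v \<Rightarrow> 'v \<Rightarrow> bool" where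
  "lepoll a b \<longleftrightarrow> (\<exists>f. ap f ` el a \<subseteq> el b \<and> inj_on (ap f) (el a))"

lemma definable_lepoll: "definable (\<lambda>s. lepoll (s 0) (s 1))"
  unfolding lepoll_def by (intro definability)
lemmas [definability] = definable_binary[OF definable_lepoll]

lemma dterm_ap1: "dterm (\<lambda>s. ap f (s 0))" by (intro definability)

lemma lepollI:
  assumes "dterm (\<lambda>s. F (s 0))" "F ` el a \<subseteq> el b" "inj_on F (el a)"
  shows "lepoll a b"
  unfolding lepoll_def
proof (intro exI conjI)
  have "\<And>x. x \<in> el a \<Longrightarrow> ap (lam a F) x = F x" using assms(1) by (rule ap_lam)
  then show "ap (lam a F) ` el a \<subseteq> el b" "inj_on (ap (lam a F)) (el a)"
    using assms by (auto simp: inj_on_def)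
qed

lemma lepollE:
  assumes "lepoll a b"
  obtains F where "dterm (\<lambda>s. F (s 0))" "F ` el a \<subseteq> el b" "inj_on F (el a)"
  using assms dterm_ap1 unfolding lepoll_def by blast

lemma lepoll_trans:
  assumes "lepoll a b" "lepoll b c"
  shows "lepoll a c"
proof -
  obtain F where F: "dterm (\<lambda>s. F (s 0))" "F ` el a \<subseteq> el b" "inj_on F (el a)"
    using assms(1) by (rule lepollE)
  obtain G where G: "dterm (\<lambda>s. G (s 0))" "G ` el b \<subseteq> el c" "inj_on G (el b)"
    using assms(2) by (rule lepollE)
  show ?thesis
  proof (rule lepollI)
    show "dterm (\<lambda>s. G (F (s 0)))" by (rule dterm_unary[OF G(1) F(1)])
    show "(\<lambda>x. G (F x)) ` el a \<subseteq> el c" using F G by blast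
    show "inj_on (\<lambda>x. G (F x)) (el a)" using F G unfolding inj_on_def by blast
  qed
qed

lemma lepoll_subset: "el a \<subseteq> el b \<Longrightarrow> lepoll a b"
  by (rule lepollI[OF dterm_var]) auto

abbreviation eqpoll :: "'v \<Rightarrow> 'v \<Rightarrow> bool" where "eqpoll \<equiv> equinumerous E"

lemma eqpollI:
  assumes "dterm (\<lambda>s. F (s 0))" "bij_betw F (el a) (el b)"
  shows "eqpoll a b"
  unfolding equinumerous_def
proof (intro exI conjI)
  show f: "is_fun E (lam a F) a b"
    using is_fun_lam[OF assms(1)] assms(2) by (simp add: bij_betw_def)
  show "bij_betw (app E (lam a F)) (el a) (el b)"
    using assms(2) by (rule bij_betw_cong[THEN iffD1, rotated])
      (simp add: app_eq_ap[OF f] ap_lam[OF assms(1)])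
qed

lemma eqpollE:
  assumes "eqpoll a b"
  obtains F where "dterm (\<lambda>s. F (s 0))" "bij_betw F (el a) (el b)"
proof -
  obtain f where f: "is_fun E f a b" "bij_betw (app E f) (el a) (el b)"
    using assms unfolding equinumerous_def by auto
  have "bij_betw (ap f) (el a) (el b)"
    using f(2) by (rule bij_betw_cong[THEN iffD1, rotated]) (simp add: app_eq_ap[OF f(1)])
  with dterm_ap1 show ?thesis by (rule that)
qed

lemma eqpoll_sym:
  assumes "eqpoll a b"
  shows "eqpoll b a"
proof -
  obtain F where F: "dterm (\<lambda>s. F (s 0))" "bij_betw F (el a) (el b)"
    using assms by (rule eqpollE)
  have i: "inj_on F (el a)" "F ` el a = el b" using F(2) by (auto simp: bij_betw_def)
  show ?thesis
  proof (rule eqpollI)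
    show "dterm (\<lambda>s. dinv F a (s 0))" by (rule dterm_dinv[OF F(1)])
    show "bij_betw (dinv F a) (el b) (el a)"
      unfolding i(2)[symmetric] by (rule bij_betw_byWitness[where f'=F]) (use i(1) in auto)
  qed
qed

lemma eqpoll_trans:
  assumes "eqpoll a b" "eqpoll b c"
  shows "eqpoll a c"
proof -
  obtain F where F: "dterm (\<lambda>s. F (s 0))" "bij_betw F (el a) (el b)"
    using assms(1) by (rule eqpollE)
  obtain G where G: "dterm (\<lambda>s. G (s 0))" "bij_betw G (el b) (el c)"
    using assms(2) by (rule eqpollE)
  show ?thesis
  proof (rule eqpollI)
    show "dterm (\<lambda>s. (G \<circ> F) (s 0))" unfolding o_def by (rule dterm_unary[OF G(1) F(1)])
    show "bij_betw (G \<circ> F) (el a) (el c)" using F G by (intro bij_betw_trans)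
  qed
qed

lemma eqpoll_lepoll: "eqpoll a b \<Longrightarrow> lepoll a b"
  by (elim eqpollE, rule lepollI) (auto simp: bij_betw_def)

text \<open>Apply \<open>F\<close> on the closure \<open>C\<close> of \<open>el a - el b\<close>
  under \<open>F\<close>, and the identity elsewhere. \<open>C\<close> is defined from above, as an
  intersection of closed sets, which avoids iterating \<open>F\<close> along \<omega>.\<close>

lemma cantor_bernstein_subset:
  assumes "lepoll a b" "el b \<subseteq> el a"
  shows "eqpoll a b"
proof -
  obtain F where F: "dterm (\<lambda>s. F (s 0))" "F ` el a \<subseteq> el b" "inj_on F (el a)"
    using assms(1) by (rule lepollE)
  note [definability] = dterm_unary[OF F(1)]
  define C where "C = {x \<in> el a. \<forall>S. el a - el b \<subseteq> el S \<and> F ` (el a \<inter> el S) \<subseteq> el S \<longrightarrow> x \<in> el S}"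
  have dC: "definable (\<lambda>s. s i \<in> C)" for i unfolding C_def by (intro definability)
  have sC: "small C"
    by (rule small_separation[OF dC small_el[of a]]) (auto simp: C_def)
  have C1: "C \<subseteq> el a" "el a - el b \<subseteq> C" by (auto simp: C_def)
  have C2: "F x \<in> C" if "x \<in> C" for x
    using that F(2) assms(2) unfolding C_def by blast
  \<comment> \<open>Minimality of \<open>C\<close>: if \<open>y\<close> had no preimage in
    \<open>C\<close>, then \<open>C\<close> without \<open>y\<close> would still be closed.\<close>
  have C3: "\<exists>x\<in>C. F x = y" if "y \<in> C" "y \<in> el b" for y
  proof (rule ccontr)
    assume n: "\<not> ?thesis"
    have s: "el (setof (C - {y})) = C - {y}"
      using small_Diff[OF sC, of "upair E y y"] by simp
    have "el a - el b \<subseteq> C - {y}" using C1 that by blast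
    moreover have "F ` (el a \<inter> (C - {y})) \<subseteq> C - {y}" using n C2 by blast
    moreover have "y \<in> el S" if "el a - el b \<subseteq> el S" "F ` (el a \<inter> el S) \<subseteq> el S" for S
      using \<open>y \<in> C\<close> that unfolding C_def by blast
    ultimately have "y \<in> el (setof (C - {y}))" unfolding s by (metis s)
    then show False unfolding s by blast
  qed
  let ?h = "\<lambda>x. if x \<in> C then F x else x"
  show ?thesis
  proof (rule eqpollI[of ?h])
    show "dterm (\<lambda>s. if s 0 \<in> C then F (s 0) else s 0)" by (intro definability dC)
    have "inj_on ?h (el a)"
      using F(3) C2 C1 unfolding inj_on_def by (metis subsetD)
    moreover have "?h ` el a \<subseteq> el b" using F(2) C1 by auto
    moreover have "y \<in> ?h ` el a" if "y \<in> el b" for y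
    proof (cases "y \<in> C")
      case True
      then obtain x where "x \<in> C" "F x = y" using C3 \<open>y \<in> el b\<close> by blast
      then show ?thesis using C1 by (intro image_eqI[of _ _ x]) auto
    next
      case False
      then show ?thesis using that assms(2) by (intro image_eqI[of _ _ y]) auto
    qed
    ultimately show "bij_betw ?h (el a) (el b)" unfolding bij_betw_def by blast
  qed
qed

text \<open>Diagonalization over an injection: \<open>D\<close> collects the codes of those subsets
  that do not contain their own code.\<close>

lemma cantor: "\<not> lepoll (power_set a) a"
proof
  assume "lepoll (power_set a) a"
  then obtain F where F: "dterm (\<lambda>s. F (s 0))" "F ` el (power_set a) \<subseteq> el a" "inj_on F (el (power_set a))"
    by (rule lepollE)
  note [definability] = dterm_unary[OF F(1)]
  define D where "D = {y \<in> el a. \<exists>S. el S \<subseteq> el a \<and> F S = y \<and> y \<notin> el S}"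
  have "small D"
    by (rule small_separation[OF _ small_el[of a]]) (unfold D_def, intro definability, auto)
  then have D: "el (setof D) = D" by simp
  have VD: "setof D \<in> el (power_set a)" unfolding el_power_set mem_Collect_eq D unfolding D_def by blast
  then have FD: "F (setof D) \<in> el a" using F(2) by blast
  have "F (setof D) \<in> D \<longleftrightarrow> F (setof D) \<notin> D"
  proof
    assume "F (setof D) \<in> D"
    then obtain S where S: "el S \<subseteq> el a" "F S = F (setof D)" "F (setof D) \<notin> el S" unfolding D_def by blast
    then have "S = setof D" using F(3) VD by (auto dest: inj_onD)
    then show "F (setof D) \<notin> D" using S D by simp
  next
    assume "F (setof D) \<notin> D"
    then have "el (setof D) \<subseteq> el a \<and> F (setof D) = F (setof D) \<and> F (setof D) \<notin> el (setof D)" using VD D by simp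
    then show "F (setof D) \<in> D" using FD unfolding D_def by blast
  qed
  then show False by blast
qed

section \<open>Choice and enumeration\<close>

lemma choice_function:
  obtains C where "dterm (\<lambda>s. C (s 0))" "\<And>S. el S \<subseteq> el A \<Longrightarrow> el S \<noteq> {} \<Longrightarrow> C S \<in> el S"
proof -
  \<comment> \<open>\<open>choice_ax\<close> speaks of disjoint families, so each nonempty subset S
    is tagged with itself: the family consists of the products of {S} with S.\<close>
  let ?fam = "(\<lambda>S. prod_set (upair E S S) S) ` (el (power_set A) - el (upair E (vempty E) (vempty E)))"
  have s: "small ?fam"
    by (intro small_image definability small_Diff small_el)
  have "(\<forall>x\<in>?fam. el x \<noteq> {}) \<and> (\<forall>x\<in>?fam. \<forall>y\<in>?fam. x \<noteq> y \<longrightarrow> el x \<inter> el y = {})"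
  proof (intro conjI ballI impI)
    fix x assume "x \<in> ?fam"
    then obtain S where S: "x = prod_set (upair E S S) S" "S \<noteq> vempty E" by auto
    then have "el S \<noteq> {}" by (metis eqI el_vempty)
    then show "el x \<noteq> {}" using S by auto
  next
    fix x y assume "x \<in> ?fam" "y \<in> ?fam" "x \<noteq> y"
    then show "el x \<inter> el y = {}" by auto
  qed
  moreover have "\<forall>a. (\<forall>x\<in>el a. el x \<noteq> {}) \<and>
          (\<forall>x\<in>el a. \<forall>y\<in>el a. x \<noteq> y \<longrightarrow> el x \<inter> el y = {}) \<longrightarrow>
          (\<exists>c. \<forall>x\<in>el a. \<exists>!y. y \<in> el x \<inter> el c)"
    using ZFC unfolding ZFC_model_def choice_ax_def by (elim conjE)
  note this[rule_format, of "setof ?fam", unfolded el_setof[OF s]]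
  ultimately have "\<exists>c. \<forall>x\<in>?fam. \<exists>!y. y \<in> el x \<inter> el c"
    by blast
  then obtain c where c: "\<And>x. x \<in> ?fam \<Longrightarrow> \<exists>!y. y \<in> el x \<inter> el c"
    by blast
  let ?C = "\<lambda>S. setof {z. \<exists>y\<in>el S. opair E S y \<in> el c \<and> z \<in> el y}"
  show ?thesis
  proof (rule that)
    show "dterm (\<lambda>s. ?C (s 0))" by (intro definability)
    fix S assume S: "el S \<subseteq> el A" "el S \<noteq> {}"
    then have "S \<noteq> vempty E" by auto
    then have "prod_set (upair E S S) S \<in> ?fam" using S(1) by simp
    then have ex1: "\<exists>!y. y \<in> el (prod_set (upair E S S) S) \<inter> el c" by (rule c)
    then obtain y where y: "y \<in> el S" "opair E S y \<in> el c" by auto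
    have "y' = y" if "y' \<in> el S" "opair E S y' \<in> el c" for y'
    proof -
      have "opair E S y' \<in> el (prod_set (upair E S S) S) \<inter> el c" "opair E S y \<in> el (prod_set (upair E S S) S) \<inter> el c"
        using y that by auto
      then have "opair E S y' = opair E S y" using ex1 by blast
      then show ?thesis by simp
    qed
    then have "{z. \<exists>y\<in>el S. opair E S y \<in> el c \<and> z \<in> el y} = el y" using y by blast
    then show "?C S \<in> el S" using y by simp
  qed
qed

text \<open>Zermelo's transfinite exhaustion of \<open>A\<close>, always choosing a remaining element of least rank.
  That the process stops before the ordinals are used up needs no Hartogs number: an initial segment
  of it is determined by its range, so Replacement applied to the power set of \<open>A\<close> bounds the lengths.\<close>

lemma enumeration:
  assumes R: "dterm (\<lambda>s. R (s 0))" "\<And>x. x \<in> el A \<Longrightarrow> Ord (R x)"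
  obtains th F where "Ord th" "dterm (\<lambda>s. F (s 0))" "bij_betw F (el th) (el A)"
    "\<And>x y. x \<in> el th \<Longrightarrow> y \<in> el x \<Longrightarrow> el (R (F y)) \<subseteq> el (R (F x))"
proof -
  obtain C where C: "dterm (\<lambda>s. C (s 0))" "\<And>S. el S \<subseteq> el A \<Longrightarrow> el S \<noteq> {} \<Longrightarrow> C S \<in> el S"
    by (rule choice_function[of A]) blast
  note [definability] = dterm_unary[OF C(1)] dterm_unary[OF R(1)]
  define M where "M S = {p \<in> el A - el S. \<forall>q\<in>el A - el S. el (R p) \<subseteq> el (R q)}" for S
  define G where "G S = C (setof (M S))" for S
  have dG: "dterm (\<lambda>s. G (s 0))" unfolding G_def M_def by (intro definability)
  note [definability] = dterm_unary[OF dG]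
  have G: "G S \<in> M S" if nsub: "\<not> el A \<subseteq> el S" for S
  proof -
    obtain q where q: "q \<in> el A - el S" using nsub by blast
    have "\<exists>p\<in>el A - el S. \<forall>q\<in>el A - el S. el (R p) \<subseteq> el (R q)"
    proof -
      have "definable (\<lambda>s. \<exists>p\<in>el A - el S. R p = s 0)" by (intro definability)
      moreover have "Ord (R q)" "\<exists>p\<in>el A - el S. R p = R q" using q R by blast+
      ultimately obtain m where m: "\<exists>p\<in>el A - el S. R p = m"
         "\<And>b. Ord b \<Longrightarrow> \<exists>p\<in>el A - el S. R p = b \<Longrightarrow> el m \<subseteq> el b"
        by (rule Ord_least[where P="\<lambda>x. \<exists>p\<in>el A - el S. R p = x"]) blast
      then show ?thesis using R by blast
    qed
    then have ne: "M S \<noteq> {}" unfolding M_def by blast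
    have sM: "small (M S)"
      by (rule small_separation[OF _ small_el[of A]]) (unfold M_def, intro definability, auto)
    have "el (setof (M S)) \<subseteq> el A" unfolding el_setof[OF sM] unfolding M_def by blast
    then show ?thesis unfolding G_def using C(2)[of "setof (M S)"] ne unfolding el_setof[OF sM] by blast
  qed
  define im where "im f y = setof (ap f ` el y)" for f y
  have dim: "dterm (\<lambda>s. im (s 0) (s 1))" unfolding im_def by (intro definability)
  note [definability] = dterm_binary[OF dim]
  have im: "el (im f y) = ap f ` el y" for f y
    unfolding im_def by (intro el_setof small_image small_el dterm_ap1)
  \<comment> \<open>\<open>f\<close> is a correct run of length \<open>x\<close>: before each step
    \<open>y\<close> something of \<open>A\<close> is left, and the step takes the choice
    \<open>G\<close> makes from the rest. Requiring a nonempty rest is what makes runs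
    injective.\<close>
  define ok where "ok x f \<longleftrightarrow> Ord x \<and> (\<forall>y\<in>el x. \<not> el A \<subseteq> el (im f y) \<and> ap f y = G (im f y))" for x f
  have dok: "definable (\<lambda>s. ok (s 0) (s 1))" unfolding ok_def by (intro definability)
  note [definability] = definable_binary[OF dok]
  have ok_M: "ap f y \<in> M (im f y)" if "ok x f" "y \<in> el x" for x f y
    using that G unfolding ok_def by auto
  then have ok_A: "ap f y \<in> el A" "ap f y \<notin> ap f ` el y" if "ok x f" "y \<in> el x" for x f y
    using that unfolding M_def im by blast+
  have ok_inj: "ap f y \<noteq> ap f z" if "ok x f" "y \<in> el x" "z \<in> el y" for x y z f
    using ok_A(2)[OF that(1,2)] that(3) by auto
  have ok_inj_on: "inj_on (ap f) (el x)" if "ok x f" for x f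
  proof (rule inj_onI, rule ccontr)
    fix y z assume "y \<in> el x" "z \<in> el x" "ap f y = ap f z" "y \<noteq> z"
    moreover have "y \<in> el z \<or> z \<in> el y"
      using calculation that Ord_linear Ord_mem unfolding ok_def by metis
    ultimately show False using ok_inj[OF that] by metis
  qed
  have ok_mono: "ok y f" if "ok x f" "y \<in> el x" for x y f
    using that Ord_mem Ord_mem_subset unfolding ok_def by blast
  have im_cong: "im f y = im g y" if "\<And>z. z \<in> el y \<Longrightarrow> ap f z = ap g z" for f g y
    by (rule eqI) (use that in \<open>simp add: im\<close>)
  have ok_unique: "ap f y = ap g y" if "ok x f" "ok x g" "y \<in> el x" for x f g y
  proof -
    have "y \<in> el x \<longrightarrow> ap f y = ap g y"
    proof (rule Ord_induct[of "\<lambda>y. y \<in> el x \<longrightarrow> ap f y = ap g y"])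
      show "definable (\<lambda>s. s 0 \<in> el x \<longrightarrow> ap f (s 0) = ap g (s 0))" by (intro definability)
      show "Ord y" using that Ord_mem unfolding ok_def by blast
      fix z assume IH: "\<And>w. w \<in> el z \<Longrightarrow> w \<in> el x \<longrightarrow> ap f w = ap g w"
      show "z \<in> el x \<longrightarrow> ap f z = ap g z"
      proof
        assume z: "z \<in> el x"
        then have "im f z = im g z"
          using IH that(1) Ord_mem_subset[of x z] unfolding ok_def by (intro im_cong) blast
        then show "ap f z = ap g z" using that z unfolding ok_def by metis
      qed
    qed
    then show ?thesis using that by blast
  qed
  \<comment> \<open>Runs agree on their common part, and a longer run has a value that the shorter
    one never takes; so the range determines the length.\<close>
  have ok_range: "x = x'" if "ok x f" "ok x' f'" "ap f ` el x = ap f' ` el x'" for x x' f f'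
  proof -
    have *: False if "ok x f" "ok x' f'" "ap f ` el x = ap f' ` el x'" "x \<in> el x'" for x x' f f'
    proof -
      have "ap f ` el x = ap f' ` el x"
        by (intro image_cong refl ok_unique[OF that(1) ok_mono[OF that(2,4)]])
      moreover have "ap f' x \<in> ap f' ` el x'" using that by blast
      ultimately show False using that ok_A(2)[OF that(2,4)] by blast
    qed
    show ?thesis using *[OF that] *[OF that(2,1) that(3)[symmetric]] Ord_linear that
      unfolding ok_def by blast
  qed
  have "\<exists>x. Ord x \<and> \<not> (\<exists>f. ok x f)"
  proof (rule ccontr)
    assume n: "\<not> ?thesis"
    let ?H = "\<lambda>S. setof {z. \<exists>x f. ok x f \<and> ap f ` el x = el S \<and> z \<in> el x}"
    have "small (?H ` el (power_set A))" by (intro small_image definability small_el)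
    moreover have "x \<in> ?H ` el (power_set A)" if o: "Ord x" for x
    proof -
      obtain f where f: "ok x f" using n o by blast
      have "{z. \<exists>x' f'. ok x' f' \<and> ap f' ` el x' = ap f ` el x \<and> z \<in> el x'} = el x"
        using f ok_range by blast
      then have "x = ?H (im f x)" by (simp add: im)
      moreover have "im f x \<in> el (power_set A)" using ok_A(1)[OF f] by (auto simp: im)
      ultimately show ?thesis by blast
    qed
    then have "{x. Ord x} \<subseteq> ?H ` el (power_set A)" by blast
    ultimately have "small {x. Ord x}" by (intro small_separation[of "{x. Ord x}"] definability)
    then show False using not_small_Ord by blast
  qed
  then obtain a where "Ord a" "\<not> (\<exists>f. ok a f)" by blast
  moreover have "definable (\<lambda>s. \<not> (\<exists>f. ok (s 0) f))" by (intro definability)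
  ultimately obtain th where th: "Ord th" "\<not> (\<exists>f. ok th f)" "\<And>b. b \<in> el th \<Longrightarrow> \<exists>f. ok b f"
    using Ord_least[of "\<lambda>x. \<not> (\<exists>f. ok x f)" a] by metis
  \<comment> \<open>\<open>th\<close> is the least length without a run. At zero the empty run
    exists and at a limit the shorter runs glue together, so \<open>th\<close> is a successor; its
    predecessor is where \<open>A\<close> is exhausted, as otherwise the run could be
    extended.\<close>
  from th(1) show ?thesis
  proof (cases rule: Ord_cases)
    case 1
    then have "ok th (vempty E)" unfolding ok_def by simp
    then show ?thesis using th(2) by blast
  next
    case 3
    let ?F = "\<lambda>y. setof {z. \<exists>f. ok (vsucc E y) f \<and> z \<in> el (ap f y)}"
    have F: "?F y = ap f y" if "ok (vsucc E y) f" for y f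
    proof -
      have "{z. \<exists>f. ok (vsucc E y) f \<and> z \<in> el (ap f y)} = el (ap f y)"
      proof (intro set_eqI iffI)
        fix z assume "z \<in> {z. \<exists>f. ok (vsucc E y) f \<and> z \<in> el (ap f y)}"
        then obtain g where "ok (vsucc E y) g" "z \<in> el (ap g y)" by blast
        then show "z \<in> el (ap f y)" using ok_unique[OF that, of g y] by simp
      qed (use that in blast)
      then show ?thesis by simp
    qed
    have dF: "dterm (\<lambda>s. ?F (s 0))" by (intro definability)
    have "ok th (lam th ?F)" unfolding ok_def[of th "lam th ?F"]
    proof (intro conjI ballI)
      show "Ord th" by fact
      fix y assume y: "y \<in> el th"
      have "vsucc E y \<in> el th" using 3 th(1) y limit_ordinal_iff by blast
      then obtain f where f: "ok (vsucc E y) f" using th(3) by blast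
      have lam: "ap (lam th ?F) z = ap f z" if z: "z \<in> el (vsucc E y)" for z
      proof -
        have zt: "z \<in> el th" using y z Ord_mem_subset[OF th(1), of y] by auto
        have "ok (vsucc E z) f"
        proof (cases "z = y")
          case False
          then have zy: "z \<in> el y" using z by simp
          have "vsucc E z \<in> el (vsucc E y)"
            using vsucc_mem_vsucc[OF Ord_mem[OF th(1) y]] zy by blast
          then show ?thesis using ok_mono[OF f] by blast
        qed (use f in simp)
        then show ?thesis unfolding ap_lam[OF dF zt] by (rule F)
      qed
      then have "im (lam th ?F) y = im f y" by (intro im_cong) simp
      moreover have "ap (lam th ?F) y = ap f y" by (rule lam) simp
      moreover have "\<not> el A \<subseteq> el (im f y) \<and> ap f y = G (im f y)" using f unfolding ok_def by simp
      ultimately show "\<not> el A \<subseteq> el (im (lam th ?F) y)" "ap (lam th ?F) y = G (im (lam th ?F) y)"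
        by simp_all
    qed
    then show ?thesis using th(2) by blast
  next
    case (2 y)
    obtain f where f: "ok y f" using th(3)[of y] 2(2) by auto
    have sub: "el A \<subseteq> ap f ` el y"
    proof (rule ccontr)
      assume n: "\<not> ?thesis"
      let ?F = "\<lambda>z. if z = y then G (im f y) else ap f z"
      have dF: "dterm (\<lambda>s. ?F (s 0))" by (intro definability)
      have lam: "ap (lam th ?F) z = ap f z" if z: "z \<in> el y" for z
      proof -
        have "ap (lam th ?F) z = ?F z" using dF by (rule ap_lam) (use z 2(2) in simp)
        then show ?thesis using z by auto
      qed
      have lamy: "ap (lam th ?F) y = G (im f y)"
      proof -
        have "ap (lam th ?F) y = ?F y" using dF by (rule ap_lam) (use 2(2) in simp)
        then show ?thesis by simp
      qed
      have "ok th (lam th ?F)" unfolding ok_def[of th "lam th ?F"]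
      proof (intro conjI ballI)
        show "Ord th" by fact
        fix z assume "z \<in> el th"
        then have z: "z = y \<or> z \<in> el y" using 2(2) by auto
        have "im (lam th ?F) z = im f z"
          using z Ord_mem_subset[OF 2(1), of z] by (intro im_cong lam) blast
        moreover have "\<not> el A \<subseteq> el (im f z) \<and> ap (lam th ?F) z = G (im f z)"
          using z f n lam[of z] lamy im unfolding ok_def by auto
        ultimately show "\<not> el A \<subseteq> el (im (lam th ?F) z)" "ap (lam th ?F) z = G (im (lam th ?F) z)"
          by simp_all
      qed
      then show False using th(2) by blast
    qed
    show ?thesis
    proof (rule that)
      show "Ord y" by fact
      show "dterm (\<lambda>s. ap f (s 0))" by (rule dterm_ap1)
      show "bij_betw (ap f) (el y) (el A)"
        unfolding bij_betw_def using ok_inj_on[OF f] ok_A(1)[OF f] sub by blast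
      \<comment> \<open>At stage \<open>z\<close> the later value \<open>ap f x\<close> was still
        available, and the value chosen had least rank.\<close>
      fix x z assume xz: "x \<in> el y" "z \<in> el x"
      have zy: "z \<in> el y" using Ord_mem_trans[OF 2(1) xz(2,1)] .
      have "el z \<subseteq> el x" using Ord_mem_subset[OF Ord_mem[OF 2(1) xz(1)] xz(2)] .
      then have "ap f x \<in> el A - el (im f z)" using ok_A[OF f xz(1)] unfolding im by blast
      then show "el (R (ap f z)) \<subseteq> el (R (ap f x))" using ok_M[OF f zy] unfolding M_def by blast
    qed
  qed
qed

section \<open>Cardinals\<close>

abbreviation Card :: "'v \<Rightarrow> bool" where "Card \<equiv> cardinal E"

text \<open>With a constant rank, \<open>enumeration\<close> is the well-ordering theorem.\<close>

lemma ex_Ord_eqpoll: "\<exists>th. Ord th \<and> eqpoll th A"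
proof -
  obtain th F where "Ord th" "dterm (\<lambda>s. F (s 0))" "bij_betw F (el th) (el A)"
    by (rule enumeration[of "\<lambda>_. vempty E" A]) (intro definability, simp)
  then show ?thesis using eqpollI by blast
qed

lemma definable_equinumerous: "definable (\<lambda>s. eqpoll (s 0) (s 1))"
proof -
  have "eqpoll a b \<longleftrightarrow> (\<exists>f. is_fun E f a b \<and> bij_betw (ap f) (el a) (el b))" for a b
    unfolding equinumerous_def
    by (rule ex_cong1, rule conj_cong, rule refl, rule bij_betw_cong) (rule app_eq_ap)
  then show ?thesis by (simp only:) (intro definability)
qed
lemmas [definability] = definable_binary[OF definable_equinumerous]

lemma definable_cardinal: "definable (\<lambda>s. Card (s 0))"
  unfolding cardinal_def by (intro definability)
lemmas [definability] = definable_unary[OF definable_cardinal]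

text \<open>Cantor-Bernstein lets injections stand in for bijections in the definition.\<close>

lemma card_iff: "Card k \<longleftrightarrow> Ord k \<and> (\<forall>b\<in>el k. \<not> lepoll k b)"
proof -
  have "eqpoll b k \<longleftrightarrow> lepoll k b" if "Ord k" "b \<in> el k" for b
  proof
    assume "eqpoll b k"
    then show "lepoll k b" by (rule eqpoll_lepoll[OF eqpoll_sym])
  next
    assume "lepoll k b"
    then show "eqpoll b k"
      by (rule eqpoll_sym[OF cantor_bernstein_subset]) (rule Ord_mem_subset[OF that])
  qed
  then show ?thesis unfolding cardinal_def by blast
qed

lemma card_Ord: "Card k \<Longrightarrow> Ord k"
  by (simp add: cardinal_def)

lemma card_lepoll_subset:
  assumes "Card k" "Ord a" "lepoll k a"
  shows "el k \<subseteq> el a"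
  using assms Ord_not_mem[OF assms(2) card_Ord[OF assms(1)]] unfolding card_iff by blast

lemma card_of: "Ord (card_of E A)" "eqpoll (card_of E A) A" "Card (card_of E A)"
proof -
  obtain th where th: "Ord th" "eqpoll th A" using ex_Ord_eqpoll by blast
  have "definable (\<lambda>s. eqpoll (s 0) A)" by (intro definability)
  note * = least_ordinal_props[of "\<lambda>b. eqpoll b A", OF this th, folded card_of_def]
  show 1: "Ord (card_of E A)" and 2: "eqpoll (card_of E A) A" by (rule *)+
  show "Card (card_of E A)"
    unfolding cardinal_def using 1 2 *(3) eqpoll_trans by blast
qed

lemma card_of_lepoll: "lepoll (card_of E A) A" "lepoll A (card_of E A)"
  by (rule eqpoll_lepoll[OF card_of(2)], rule eqpoll_lepoll[OF eqpoll_sym[OF card_of(2)]])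

lemma card_of_subset: "Ord a \<Longrightarrow> lepoll A a \<Longrightarrow> el (card_of E A) \<subseteq> el a"
  using card_lepoll_subset[OF card_of(3)] lepoll_trans card_of_lepoll by blast

text \<open>Here \<open>a\<close> may be any ordinal; strict inequalities with cardinal powers
  become the absence of an injection.\<close>

lemma mem_card_of: "Ord a \<Longrightarrow> a \<in> el (card_of E A) \<longleftrightarrow> \<not> lepoll A a"
  using Ord_not_mem[of a "card_of E A"] card_of(1) card_of_subset[of a A]
  by (meson card_of_lepoll(2) lepoll_subset lepoll_trans)

lemma card_succ:
  assumes "Ord d"
  shows "Card (card_succ E d)" "d \<in> el (card_succ E d)"
    "\<And>k. Card k \<Longrightarrow> d \<in> el k \<Longrightarrow> el (card_succ E d) \<subseteq> el k"
proof -
  let ?c = "card_of E (power_set d)"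
  have 1: "Ord ?c" by (rule card_of)
  \<comment> \<open>By Cantor, the size of the power set is a cardinal above \<open>d\<close>, so a
    least such cardinal exists.\<close>
  have 2: "Card ?c \<and> E d ?c"
    using card_of(3) mem_card_of[OF assms, of "power_set d"] cantor by (simp add: elts_def)
  have d: "definable (\<lambda>s. Card (s 0) \<and> E d (s 0))" by (intro definability)
  note * = least_ordinal_props[of "\<lambda>k. Card k \<and> E d k", OF d 1 2, folded card_succ_def]
  show "Card (card_succ E d)" using *(2) by simp
  show "d \<in> el (card_succ E d)" using *(2) by (simp add: elts_def)
  show "el (card_succ E d) \<subseteq> el k" if "Card k" "d \<in> el k" for k
    using *(4)[of k] that card_Ord by (simp add: elts_def)
qed

lemma lepoll_of_mem_card_succ:
  assumes "Card d" "b \<in> el (card_succ E d)"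
  shows "lepoll b d"
proof -
  note c = card_succ[OF card_Ord[OF assms(1)]]
  have b: "Ord b" using Ord_mem[OF card_Ord[OF c(1)] assms(2)] .
  have "\<not> d \<in> el (card_of E b)"
  proof
    assume "d \<in> el (card_of E b)"
    then have "el (card_succ E d) \<subseteq> el (card_of E b)" using c(3) card_of(3) by blast
    also have "\<dots> \<subseteq> el b" by (rule card_of_subset[OF b lepoll_subset]) simp
    finally show False using assms(2) by auto
  qed
  then show ?thesis using mem_card_of[OF card_Ord[OF assms(1)]] by blast
qed

section \<open>Finite sets\<close>

lemma vsucc_inject: "vsucc E x = vsucc E y \<Longrightarrow> x = y"
  by (metis el_vsucc insert_iff not_mem_cycle2)

lemma not_lepoll_vsucc:
  assumes "n \<in> el om"
  shows "\<not> lepoll (vsucc E n) n"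
proof (rule om_induct[of "\<lambda>n. \<not> lepoll (vsucc E n) n", OF _ assms])
  show "definable (\<lambda>s. \<not> lepoll (vsucc E (s 0)) (s 0))" by (intro definability)
  show "\<not> lepoll (vsucc E (vempty E)) (vempty E)" unfolding lepoll_def by auto
  fix n assume n: "\<not> lepoll (vsucc E n) n"
  show "\<not> lepoll (vsucc E (vsucc E n)) (vsucc E n)"
  proof
    let ?m = "vsucc E n"
    assume "lepoll (vsucc E ?m) ?m"
    then obtain F where F: "dterm (\<lambda>s. F (s 0))" "F ` el (vsucc E ?m) \<subseteq> el ?m" "inj_on F (el (vsucc E ?m))"
      by (rule lepollE)
    note [definability] = dterm_unary[OF F(1)]
    let ?G = "\<lambda>x. if F x = n then F ?m else F x"
    have i: "F x = F y \<longleftrightarrow> x = y" if "x \<in> insert ?m (el ?m)" "y \<in> insert ?m (el ?m)" for x y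
      using inj_on_eq_iff[OF F(3), of x y] that by simp
    have m: "x \<noteq> ?m" if "x \<in> el ?m" for x using that not_mem_self by blast
    have r: "F x = n \<or> F x \<in> el n" if "x \<in> insert ?m (el ?m)" for x
      using F(2) that by auto
    have "lepoll ?m n"
    proof (rule lepollI)
      show "dterm (\<lambda>s. ?G (s 0))" by (intro definability)
      show "?G ` el ?m \<subseteq> el n"
      proof (rule image_subsetI)
        fix x assume x: "x \<in> el ?m"
        then show "?G x \<in> el n" using r[of x] r[of ?m] i[of x ?m] m[OF x] by auto
      qed
      show "inj_on ?G (el ?m)"
      proof (rule inj_onI)
        fix x y assume xy: "x \<in> el ?m" "y \<in> el ?m" "?G x = ?G y"
        show "x = y" using xy(3) i[of x y] i[of x ?m] i[of y ?m] m[OF xy(1)] m[OF xy(2)] xy(1,2)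
          by (auto split: if_splits)
      qed
    qed
    with n show False ..
  qed
qed

lemma card_om: "Card om"
  unfolding card_iff
proof (intro conjI ballI Ord_om notI)
  fix n assume n: "n \<in> el om" "lepoll om n"
  have "lepoll (vsucc E n) om"
    using vsucc_om[OF n(1)] by (intro lepoll_subset Ord_mem_subset[OF Ord_om])
  then show False using not_lepoll_vsucc[OF n(1)] lepoll_trans n(2) by blast
qed

definition finite_set :: "'v \<Rightarrow> bool" where
  "finite_set X \<longleftrightarrow> (\<exists>k\<in>el om. lepoll X k)"

lemma definable_finite_set: "definable (\<lambda>s. finite_set (s 0))"
  unfolding finite_set_def by (intro definability)
lemmas [definability] = definable_unary[OF definable_finite_set]

lemma finite_set_insert:
  assumes "finite_set X" "el Y = insert y (el X)"
  shows "finite_set Y"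
proof -
  obtain k where k: "k \<in> el om" "lepoll X k" using assms(1) finite_set_def by auto
  obtain F where F: "dterm (\<lambda>s. F (s 0))" "F ` el X \<subseteq> el k" "inj_on F (el X)"
    using k(2) by (rule lepollE)
  note [definability] = dterm_unary[OF F(1)]
  let ?G = "\<lambda>z. if z \<in> el X then F z else k"
  have Fk: "F z \<noteq> k" if "z \<in> el X" for z using F(2) that not_mem_self by blast
  have "lepoll Y (vsucc E k)"
  proof (rule lepollI)
    show "dterm (\<lambda>s. ?G (s 0))" by (intro definability)
    show "?G ` el Y \<subseteq> el (vsucc E k)" using F(2) by auto
    show "inj_on ?G (el Y)"
      using F(3) Fk Fk[symmetric] unfolding assms(2) inj_on_def by auto
  qed
  then show ?thesis using vsucc_om[OF k(1)] finite_set_def by blast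
qed

text \<open>Double induction: the outer step adds the row of \<open>m\<close>, the inner one adds
  that row point by point through \<open>finite_set_insert\<close>.\<close>

lemma finite_set_prod_set:
  assumes "m \<in> el om" "n \<in> el om"
  shows "finite_set (prod_set m n)"
proof (rule om_induct[of "\<lambda>m. finite_set (prod_set m n)", OF _ assms(1)])
  show "definable (\<lambda>s. finite_set (prod_set (s 0) n))" by (intro definability)
  have "prod_set (vempty E) n = vempty E" by (rule eqI) simp
  then show "finite_set (prod_set (vempty E) n)"
    unfolding finite_set_def using vempty_om by (auto intro: lepoll_subset)
  fix m assume m: "finite_set (prod_set m n)"
  have sm: "small (el (prod_set m n) \<union> el (prod_set (upair E m m) j))" for j
    by (intro small_Un small_el)
  have "finite_set (setof (el (prod_set m n) \<union> el (prod_set (upair E m m) n)))"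
  proof (rule om_induct[of "\<lambda>j. finite_set (setof (el (prod_set m n) \<union> el (prod_set (upair E m m) j)))", OF _ assms(2)])
    show "definable (\<lambda>s. finite_set (setof (el (prod_set m n) \<union> el (prod_set (upair E m m) (s 0)))))" by (intro definability)
    show "finite_set (setof (el (prod_set m n) \<union> el (prod_set (upair E m m) (vempty E))))"
    proof -
      have "setof (el (prod_set m n) \<union> el (prod_set (upair E m m) (vempty E))) = prod_set m n"
        by (rule eqI, unfold el_setof[OF sm]) auto
      then show ?thesis using m by simp
    qed
    fix j assume j: "finite_set (setof (el (prod_set m n) \<union> el (prod_set (upair E m m) j)))"
    show "finite_set (setof (el (prod_set m n) \<union> el (prod_set (upair E m m) (vsucc E j))))"
      by (rule finite_set_insert[OF j, of _ "opair E m j"], unfold el_setof[OF sm]) auto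
  qed
  moreover have "setof (el (prod_set m n) \<union> el (prod_set (upair E m m) n)) = prod_set (vsucc E m) n"
    by (rule eqI, unfold el_setof[OF sm]) auto
  ultimately show "finite_set (prod_set (vsucc E m) n)" by simp
qed

section \<open>Squares and unions of infinite cardinals, regularity of successors\<close>

lemma infinite_card_vsucc:
  assumes "Card k" "el om \<subseteq> el k" "x \<in> el k"
  shows "vsucc E x \<in> el k"
proof (rule ccontr)
  assume n: "\<not> ?thesis"
  have k: "Ord k" using assms(1) by (rule card_Ord)
  have x: "Ord x" using Ord_mem[OF k assms(3)] .
  have "el k \<subseteq> el (vsucc E x)" using n Ord_not_mem[OF Ord_vsucc[OF x] k] by blast
  moreover have "el (vsucc E x) \<subseteq> el k" using assms(3) Ord_mem_subset[OF k assms(3)] by simp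
  ultimately have kx: "k = vsucc E x" by (intro eqI) blast
  have "x \<notin> el om"
  proof
    assume "x \<in> el om"
    then have "k \<in> el k" using vsucc_om kx assms(2) by blast
    then show False by simp
  qed
  then have ox: "el om \<subseteq> el x" using Ord_not_mem[OF x Ord_om] by blast
  \<comment> \<open>Hilbert's hotel: the last element \<open>x\<close> goes to zero, \<omega> shifts
    by one, the rest is fixed. So \<open>k\<close>, the successor of \<open>x\<close>, would embed
    in \<open>x\<close>.\<close>
  let ?G = "\<lambda>z. if z = x then vempty E else if z \<in> el om then vsucc E z else z"
  have "lepoll k x"
  proof (rule lepollI)
    show "dterm (\<lambda>s. ?G (s 0))" by (intro definability)
    show "?G ` el k \<subseteq> el x" using ox vsucc_om vempty_om unfolding kx by auto
    show "inj_on ?G (el k)"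
    proof (rule inj_onI)
      fix a b assume ab: "?G a = ?G b"
      have 1: "vempty E \<noteq> vsucc E z" for z
      proof
        assume "vempty E = vsucc E z"
        then have "el (vempty E) = el (vsucc E z)" by (rule arg_cong)
        then show False by simp
      qed
      show "a = b" using ab 1 1[symmetric] vsucc_om vsucc_inject[of a b] vempty_om by (auto split: if_splits)
    qed
  qed
  then show False using assms(1,3) unfolding card_iff by blast
qed

lemma lepoll_prod_set:
  assumes "lepoll a c" "lepoll b d"
  shows "lepoll (prod_set a b) (prod_set c d)"
proof -
  obtain F where F: "dterm (\<lambda>s. F (s 0))" "F ` el a \<subseteq> el c" "inj_on F (el a)"
    using assms(1) by (rule lepollE)
  obtain G where G: "dterm (\<lambda>s. G (s 0))" "G ` el b \<subseteq> el d" "inj_on G (el b)"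
    using assms(2) by (rule lepollE)
  note [definability] = dterm_unary[OF F(1)] dterm_unary[OF G(1)]
  show ?thesis
  proof (rule lepollI)
    show "dterm (\<lambda>s. opair E (F (pfst (s 0))) (G (psnd (s 0))))" by (intro definability)
    show "(\<lambda>p. opair E (F (pfst p)) (G (psnd p))) ` el (prod_set a b) \<subseteq> el (prod_set c d)"
      using F(2) G(2) by (auto simp: image_subset_iff)
    show "inj_on (\<lambda>p. opair E (F (pfst p)) (G (psnd p))) (el (prod_set a b))"
      using F(3) G(3) by (auto simp: inj_on_def)
  qed
qed

text \<open>The inductive use of Hessenberg. For \<open>k = om\<close> the square is finite;
  otherwise \<open>g\<close> is enlarged to contain \<omega> and replaced by its cardinality, an
  infinite cardinal below \<open>k\<close>.\<close>

lemma square_below_card: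
  assumes k: "Card k" "el om \<subseteq> el k"
    and IH: "\<And>m. m \<in> el k \<Longrightarrow> Card m \<and> el om \<subseteq> el m \<Longrightarrow> lepoll (prod_set m m) m"
    and g: "g \<in> el k"
  shows "\<exists>m\<in>el k. lepoll (prod_set g g) m"
proof (cases "om \<in> el k")
  case False
  then have "el k \<subseteq> el om" using Ord_not_mem[OF Ord_om card_Ord[OF k(1)]] by blast
  then have "k = om" using k(2) by (intro eqI) blast
  then show ?thesis using finite_set_prod_set[of g g] g unfolding finite_set_def by blast
next
  case True
  have ok: "Ord k" by (rule card_Ord[OF k(1)])
  have "\<exists>h\<in>el k. el g \<subseteq> el h \<and> el om \<subseteq> el h"
    using Ord_subset_linear[OF Ord_mem[OF ok g] Ord_om] True g by blast
  then obtain h where h: "h \<in> el k" "el g \<subseteq> el h" "el om \<subseteq> el h" by blast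
  have oh: "Ord h" by (rule Ord_mem[OF ok h(1)])
  let ?m = "card_of E h"
  have "el ?m \<subseteq> el h" by (intro card_of_subset oh lepoll_subset subset_refl)
  then have "k \<notin> el ?m" using h(1) not_mem_cycle2 by blast
  moreover have "?m \<noteq> k" using \<open>el ?m \<subseteq> el h\<close> h(1) not_mem_self by blast
  ultimately have mk: "?m \<in> el k" using Ord_linear[OF ok card_of(1)] by blast
  have "lepoll om ?m" using lepoll_subset[OF h(3)] lepoll_trans card_of_lepoll by blast
  then have "el om \<subseteq> el ?m" by (intro card_lepoll_subset card_om card_of)
  then have "lepoll (prod_set ?m ?m) ?m" using IH[OF mk] card_of(3) by blast
  moreover have "lepoll g ?m" using lepoll_subset[OF h(2)] lepoll_trans card_of_lepoll by blast
  ultimately show ?thesis using mk lepoll_prod_set lepoll_trans by blast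
qed

text \<open>Hessenberg's theorem: enumerate \<open>k \<times> k\<close> with increasing maximum of the two components, so
  that the pairs preceding a given one lie in the square of a smaller ordinal.\<close>

lemma hessenberg:
  assumes "Card k" "el om \<subseteq> el k"
  shows "lepoll (prod_set k k) k"
proof -
  have "Card k \<and> el om \<subseteq> el k \<longrightarrow> lepoll (prod_set k k) k"
  proof (rule Ord_induct[of "\<lambda>k. Card k \<and> el om \<subseteq> el k \<longrightarrow> lepoll (prod_set k k) k"])
    show "definable (\<lambda>s. Card (s 0) \<and> el om \<subseteq> el (s 0) \<longrightarrow> lepoll (prod_set (s 0) (s 0)) (s 0))"
      by (intro definability)
    show "Ord k" using assms card_Ord by blast
    fix k assume k: "Ord k" and IH: "\<And>m. m \<in> el k \<Longrightarrow> Card m \<and> el om \<subseteq> el m \<longrightarrow> lepoll (prod_set m m) m"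
    show "Card k \<and> el om \<subseteq> el k \<longrightarrow> lepoll (prod_set k k) k"
    proof
      assume c: "Card k \<and> el om \<subseteq> el k"
      \<comment> \<open>For ordinals, the union of the two components is their maximum.\<close>
      let ?R = "\<lambda>p. setof (el (pfst p) \<union> el (psnd p))"
      have elR: "el (?R p) = el (pfst p) \<union> el (psnd p)" for p
        by (intro el_setof small_Un small_el)
      have RM: "?R p \<in> el k" if "p \<in> el (prod_set k k)" for p
      proof -
        obtain x y where p: "p = opair E x y" "x \<in> el k" "y \<in> el k" using \<open>p \<in> _\<close> by auto
        have "el (?R p) = el x \<union> el y" unfolding elR p(1) by simp
        moreover have "el x \<subseteq> el y \<or> el y \<subseteq> el x"
          using Ord_subset_linear Ord_mem[OF k] p by blast
        ultimately have "?R p = x \<or> ?R p = y" by (metis eqI Un_absorb1 Un_absorb2)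
        then show ?thesis using p(2,3) by metis
      qed
      obtain th F where F: "Ord th" "dterm (\<lambda>s. F (s 0))" "bij_betw F (el th) (el (prod_set k k))"
        "\<And>x y. x \<in> el th \<Longrightarrow> y \<in> el x \<Longrightarrow> el (?R (F y)) \<subseteq> el (?R (F x))"
      proof (rule enumeration[of ?R "prod_set k k"])
        show "dterm (\<lambda>s. ?R (s 0))" by (intro definability)
        show "Ord (?R x)" if "x \<in> el (prod_set k k)" for x using Ord_mem[OF k RM[OF that]] .
      qed blast
      \<comment> \<open>The pair at position \<open>k\<close> would have \<open>k\<close> many
        predecessors, all with components at most its maximum \<open>?g\<close>, hence in the square
        of the successor of \<open>?g\<close>. That square is smaller than \<open>k\<close>.\<close>
      have "k \<notin> el th"
      proof
        assume kt: "k \<in> el th"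
        let ?g = "?R (F k)"
        have "F k \<in> el (prod_set k k)" using bij_betwE[OF F(3)] kt by blast
        then have gk: "?g \<in> el k" by (rule RM)
        then have "vsucc E ?g \<in> el k" using infinite_card_vsucc c by blast
        then have "\<exists>m\<in>el k. lepoll (prod_set (vsucc E ?g) (vsucc E ?g)) m"
          using c IH by (intro square_below_card) auto
        then obtain m where m: "m \<in> el k" "lepoll (prod_set (vsucc E ?g) (vsucc E ?g)) m" by blast
        have "lepoll k (prod_set (vsucc E ?g) (vsucc E ?g))"
        proof (rule lepollI[OF F(2)])
          have kth: "el k \<subseteq> el th" by (rule Ord_mem_subset[OF F(1) kt])
          then show "inj_on F (el k)" using F(3) unfolding bij_betw_def by (blast intro: inj_on_subset)
          show "F ` el k \<subseteq> el (prod_set (vsucc E ?g) (vsucc E ?g))"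
          proof (rule image_subsetI)
            fix e assume e: "e \<in> el k"
            have "F e \<in> el (prod_set k k)" using bij_betwE[OF F(3)] e kth by blast
            then obtain x y where p: "F e = opair E x y" "x \<in> el k" "y \<in> el k" by auto
            have "el (?R (F e)) \<subseteq> el ?g" by (rule F(4)[OF kt e])
            then have "el x \<subseteq> el ?g" "el y \<subseteq> el ?g" using elR[of "F e"] p(1) by auto
            moreover have "z \<in> el (vsucc E ?g)" if "el z \<subseteq> el ?g" "z \<in> el k" for z
              using that Ord_not_mem[of ?g z] Ord_linear[of ?g z] Ord_mem[OF k] gk by auto
            ultimately have "x \<in> el (vsucc E ?g)" "y \<in> el (vsucc E ?g)" using p by blast+
            then show "F e \<in> el (prod_set (vsucc E ?g) (vsucc E ?g))" using p(1) by auto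
          qed
        qed
        then show False using m c lepoll_trans unfolding card_iff by blast
      qed
      then have "el th \<subseteq> el k" using Ord_not_mem[OF k F(1)] by blast
      moreover have "lepoll (prod_set k k) th" by (rule eqpoll_lepoll[OF eqpoll_sym[OF eqpollI[OF F(2,3)]]])
      ultimately show "lepoll (prod_set k k) k" using lepoll_subset lepoll_trans by blast
    qed
  qed
  then show ?thesis using assms by blast
qed

text \<open>Each element is sent to a chosen index and its image under a chosen injection of that
  member of the family; Hessenberg then shrinks the pairs back to \<open>k\<close>.\<close>

lemma lepoll_UN:
  assumes k: "Card k" "el om \<subseteq> el k" and I: "el I \<subseteq> el k"
    and X: "dterm (\<lambda>s. X (s 0))" "\<And>i. i \<in> el I \<Longrightarrow> lepoll (X i) k"
    and Y: "el Y \<subseteq> (\<Union>i\<in>el I. el (X i))"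
  shows "lepoll Y k"
proof -
  note [definability] = dterm_unary[OF X(1)]
  have sU: "small (\<Union>i\<in>el I. el (X i))" by (intro small_UN X(1) small_el)
  \<comment> \<open>\<open>W\<close> contains the graphs of all functions from any
    \<open>X i\<close> into \<open>k\<close>, so one choice function selects the injections for all
    indices.\<close>
  define W where "W = power_set (prod_set (setof (\<Union>i\<in>el I. el (X i))) k)"
  obtain C where C: "dterm (\<lambda>s. C (s 0))" "\<And>S. el S \<subseteq> el W \<Longrightarrow> el S \<noteq> {} \<Longrightarrow> C S \<in> el S"
    by (rule choice_function[of W]) blast
  obtain J where J: "dterm (\<lambda>s. J (s 0))" "\<And>S. el S \<subseteq> el I \<Longrightarrow> el S \<noteq> {} \<Longrightarrow> J S \<in> el S"
    by (rule choice_function[of I]) blast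
  note [definability] = dterm_unary[OF C(1)] dterm_unary[OF J(1)]
  let ?P = "\<lambda>i. {f \<in> el W. ap f ` el (X i) \<subseteq> el k \<and> inj_on (ap f) (el (X i))}"
  let ?Q = "\<lambda>y. {i \<in> el I. y \<in> el (X i)}"
  define g where "g i = C (setof (?P i))" for i
  define j where "j y = J (setof (?Q y))" for y
  have dg: "dterm (\<lambda>s. g (s 0))" unfolding g_def by (intro definability)
  have dj: "dterm (\<lambda>s. j (s 0))" unfolding j_def by (intro definability)
  note [definability] = dterm_unary[OF dg] dterm_unary[OF dj]
  have g: "g i \<in> ?P i" if i: "i \<in> el I" for i
  proof -
    have sP: "small (?P i)"
      by (rule small_separation[OF _ small_el[of W]]) (intro definability, auto)
    obtain F where F: "dterm (\<lambda>s. F (s 0))" "F ` el (X i) \<subseteq> el k" "inj_on F (el (X i))"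
      using X(2)[OF i] by (rule lepollE)
    have apF: "ap (lam (X i) F) x = F x" if "x \<in> el (X i)" for x
      using F(1) that by (rule ap_lam)
    have "lam (X i) F \<in> el W"
      unfolding W_def using F(2) i by (auto simp: el_lam[OF F(1)] el_setof[OF sU] image_subset_iff)
    moreover have "ap (lam (X i) F) ` el (X i) \<subseteq> el k" using F(2) apF by auto
    moreover have "inj_on (ap (lam (X i) F)) (el (X i))"
      using F(3) by (rule inj_on_cong[THEN iffD1, rotated]) (simp add: apF)
    ultimately have "?P i \<noteq> {}" by blast
    then show ?thesis using C(2)[of "setof (?P i)"] unfolding el_setof[OF sP] g_def by blast
  qed
  have j: "j y \<in> ?Q y" if y: "y \<in> el Y" for y
  proof -
    have sQ: "small (?Q y)"
      by (rule small_separation[OF _ small_el[of I]]) (intro definability, auto)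
    have "?Q y \<noteq> {}" using Y y by blast
    then show ?thesis using J(2)[of "setof (?Q y)"] unfolding el_setof[OF sQ] j_def by blast
  qed
  have "lepoll Y (prod_set k k)"
  proof (rule lepollI)
    let ?h = "\<lambda>y. opair E (j y) (ap (g (j y)) y)"
    show "dterm (\<lambda>s. ?h (s 0))" by (intro definability)
    have "?h y \<in> el (prod_set k k)" if "y \<in> el Y" for y
    proof -
      have "j y \<in> el I" "y \<in> el (X (j y))" using j[OF that] by blast+
      then have "j y \<in> el k" "ap (g (j y)) y \<in> el k" using I g[of "j y"] by blast+
      then show ?thesis by simp
    qed
    then show "?h ` el Y \<subseteq> el (prod_set k k)" by blast
    show "inj_on ?h (el Y)"
    proof (rule inj_onI)
      fix y z assume yz: "y \<in> el Y" "z \<in> el Y" "?h y = ?h z"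
      then have e1: "j z = j y" by simp
      have e2: "ap (g (j y)) y = ap (g (j y)) z" using yz(3) unfolding e1 by simp
      have "j y \<in> el I" "y \<in> el (X (j y))" "z \<in> el (X (j y))"
        using j[OF yz(1)] j[OF yz(2)] unfolding e1 by blast+
      then show "y = z" using g[of "j y"] e2 by (auto dest: inj_onD)
    qed
  qed
  then show ?thesis using hessenberg[OF k] lepoll_trans by blast
qed

text \<open>Otherwise the successors of the values \<open>F i\<close>, at most \<open>d\<close> many
  sets of size at most \<open>d\<close>, would cover \<open>card_succ E d\<close>. Successors are
  taken because a point may equal some \<open>F i\<close>.\<close>

lemma card_succ_regular:
  assumes d: "Card d" "el om \<subseteq> el d" and I: "el I \<subseteq> el d"
    and F: "dterm (\<lambda>s. F (s 0))" "\<And>i. i \<in> el I \<Longrightarrow> F i \<in> el (card_succ E d)"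
  shows "\<exists>x\<in>el (card_succ E d). \<forall>i\<in>el I. F i \<in> el x"
proof (rule ccontr)
  let ?k = "card_succ E d"
  note c = card_succ[OF card_Ord[OF d(1)]]
  note [definability] = dterm_unary[OF F(1)]
  have ok: "Ord ?k" by (rule card_Ord[OF c(1)])
  have dk: "el d \<subseteq> el ?k" by (rule Ord_mem_subset[OF ok c(2)])
  assume n: "\<not> ?thesis"
  have "lepoll ?k d"
  proof (rule lepoll_UN[OF d I])
    show "dterm (\<lambda>s. vsucc E (F (s 0)))" by (intro definability)
    show "lepoll (vsucc E (F i)) d" if "i \<in> el I" for i
      using that F(2) infinite_card_vsucc[OF c(1)] d(2) dk by (intro lepoll_of_mem_card_succ d(1)) blast
    show "el ?k \<subseteq> (\<Union>i\<in>el I. el (vsucc E (F i)))"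
    proof
      fix x assume x: "x \<in> el ?k"
      then obtain i where i: "i \<in> el I" "F i \<notin> el x" using n by blast
      then have "x = F i \<or> x \<in> el (F i)"
        using Ord_linear[OF Ord_mem[OF ok x] Ord_mem[OF ok F(2)[OF i(1)]]] by blast
      then show "x \<in> (\<Union>i\<in>el I. el (vsucc E (F i)))" using i by auto
    qed
  qed
  then show False using c(1,2) unfolding card_iff by blast
qed

section \<open>Cofinality\<close>

text \<open>Cofinality with inclusion for the order and \<open>ap\<close> for application, a form
  suited to definability; for an ordinal \<open>a\<close>, \<open>cof_iff\<close> shows that nothing
  changes.\<close>

definition cof :: "'v \<Rightarrow> 'v \<Rightarrow> bool" where
  "cof b a \<longleftrightarrow> (\<exists>f. ap f ` el b \<subseteq> el a \<and> (\<forall>x\<in>el a. \<exists>y\<in>el b. el x \<subseteq> el (ap f y)))"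

lemma definable_cof: "definable (\<lambda>s. cof (s 0) (s 1))"
  unfolding cof_def by (intro definability)
lemmas [definability] = definable_binary[OF definable_cof]

lemma cofI:
  assumes "dterm (\<lambda>s. F (s 0))" "F ` el b \<subseteq> el a" "\<And>x. x \<in> el a \<Longrightarrow> \<exists>y\<in>el b. el x \<subseteq> el (F y)"
  shows "cof b a"
  unfolding cof_def
proof (intro exI conjI ballI)
  have *: "\<And>x. x \<in> el b \<Longrightarrow> ap (lam b F) x = F x" using assms(1) by (rule ap_lam)
  then show "ap (lam b F) ` el b \<subseteq> el a" using assms(2) by auto
  show "\<exists>y\<in>el b. el x \<subseteq> el (ap (lam b F) y)" if "x \<in> el a" for x
    using assms(3)[OF that] * by auto
qed

lemma cofE:
  assumes "cof b a"
  obtains f where "ap f ` el b \<subseteq> el a" "\<And>x. x \<in> el a \<Longrightarrow> \<exists>y\<in>el b. el x \<subseteq> el (ap f y)"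
proof -
  obtain f where f: "ap f ` el b \<subseteq> el a \<and> (\<forall>x\<in>el a. \<exists>y\<in>el b. el x \<subseteq> el (ap f y))"
    using assms unfolding cof_def ..
  show ?thesis
    by (rule that[OF conjunct1[OF f] bspec[OF conjunct2[OF f]]])
qed

lemma cof_iff:
  assumes "Ord a"
  shows "(\<exists>f. is_fun E f b a \<and> (\<forall>x\<in>el a. \<exists>y\<in>el b. ord_le E x (app E f y))) \<longleftrightarrow> cof b a"
proof
  assume "\<exists>f. is_fun E f b a \<and> (\<forall>x\<in>el a. \<exists>y\<in>el b. ord_le E x (app E f y))"
  then obtain f where f: "is_fun E f b a" "\<And>x. x \<in> el a \<Longrightarrow> \<exists>y\<in>el b. ord_le E x (app E f y)" by blast
  show "cof b a" unfolding cof_def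
  proof (intro exI conjI ballI)
    show "ap f ` el b \<subseteq> el a" using is_fun_ap_mem[OF f(1)] by blast
    fix x assume x: "x \<in> el a"
    then obtain y where y: "y \<in> el b" "ord_le E x (ap f y)" using f(2) app_eq_ap[OF f(1)] by metis
    then show "\<exists>y\<in>el b. el x \<subseteq> el (ap f y)"
      using ord_le_iff[OF Ord_mem[OF assms x] Ord_mem[OF assms is_fun_ap_mem[OF f(1) y(1)]]] by blast
  qed
next
  assume "cof b a"
  then obtain f where f: "ap f ` el b \<subseteq> el a" "\<And>x. x \<in> el a \<Longrightarrow> \<exists>y\<in>el b. el x \<subseteq> el (ap f y)"
    by (rule cofE) (rule that)
  let ?g = "lam b (ap f)"
  have g: "is_fun E ?g b a" by (rule is_fun_lam[OF dterm_ap1 f(1)])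
  have "\<exists>y\<in>el b. ord_le E x (app E ?g y)" if x: "x \<in> el a" for x
  proof -
    obtain y where y: "y \<in> el b" "el x \<subseteq> el (ap f y)" using f(2)[OF x] by blast
    have "app E ?g y = ap f y"
      using app_eq_ap[OF g y(1)] ap_lam[OF dterm_ap1 y(1)] by simp
    moreover have "ap f y \<in> el a" using f(1) y(1) by blast
    ultimately have "ord_le E x (app E ?g y)"
      using ord_le_iff[OF Ord_mem[OF assms x] Ord_mem[OF assms]] y(2) by metis
    then show ?thesis using y(1) by blast
  qed
  then show "\<exists>f. is_fun E f b a \<and> (\<forall>x\<in>el a. \<exists>y\<in>el b. ord_le E x (app E f y))" using g by blast
qed

text \<open>Replaces the definite description by a formula. The hypothesis class of the theorem
  thereby becomes definable, as Separation requires.\<close>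

lemma cofinality_eq_iff:
  assumes "Ord a"
  shows "cofinality E a = b \<longleftrightarrow> Ord b \<and> cof b a \<and> (\<forall>c\<in>el b. \<not> cof c a)"
proof -
  have c: "cofinality E a = least_ordinal E (\<lambda>b. cof b a)"
    unfolding cofinality_def cof_iff[OF assms] ..
  have "definable (\<lambda>s. cof (s 0) a)" by (intro definability)
  moreover have "cof a a" by (rule cofI[OF dterm_var]) auto
  ultimately have *: "Ord (cofinality E a)" "cof (cofinality E a) a" "\<And>b. b \<in> el (cofinality E a) \<Longrightarrow> \<not> cof b a"
    unfolding c using least_ordinal_props[of "\<lambda>b. cof b a", OF _ assms] by blast+
  show ?thesis
  proof
    assume "cofinality E a = b"
    then show "Ord b \<and> cof b a \<and> (\<forall>c\<in>el b. \<not> cof c a)" using * by blast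
  next
    assume "Ord b \<and> cof b a \<and> (\<forall>c\<in>el b. \<not> cof c a)"
    then show "cofinality E a = b" unfolding c by (intro least_ordinal_eq) blast+
  qed
qed

text \<open>Finitely many elements have a strict bound: the inductive step takes the larger of the
  old bound and the successor of the new value. It pins a countable cofinality down to exactly
  \<omega>.\<close>

lemma not_cof_finite:
  assumes d: "Card d" "el om \<subseteq> el d" and n: "n \<in> el om"
  shows "\<not> cof n d"
proof -
  have od: "Ord d" by (rule card_Ord[OF d(1)])
  have "\<forall>f. ap f ` el n \<subseteq> el d \<longrightarrow> (\<exists>x\<in>el d. \<forall>i\<in>el n. ap f i \<in> el x)"
  proof (rule om_induct[of "\<lambda>n. \<forall>f. ap f ` el n \<subseteq> el d \<longrightarrow> (\<exists>x\<in>el d. \<forall>i\<in>el n. ap f i \<in> el x)", OF _ n])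
    show "definable (\<lambda>s. \<forall>f. ap f ` el (s 0) \<subseteq> el d \<longrightarrow> (\<exists>x\<in>el d. \<forall>i\<in>el (s 0). ap f i \<in> el x))"
      by (intro definability)
    have "vempty E \<in> el d" using d(2) vempty_om by blast
    then show "\<forall>f. ap f ` el (vempty E) \<subseteq> el d \<longrightarrow> (\<exists>x\<in>el d. \<forall>i\<in>el (vempty E). ap f i \<in> el x)"
      by auto
    fix n assume IH: "\<forall>f. ap f ` el n \<subseteq> el d \<longrightarrow> (\<exists>x\<in>el d. \<forall>i\<in>el n. ap f i \<in> el x)"
    show "\<forall>f. ap f ` el (vsucc E n) \<subseteq> el d \<longrightarrow> (\<exists>x\<in>el d. \<forall>i\<in>el (vsucc E n). ap f i \<in> el x)"
    proof (intro allI impI)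
      fix f assume f: "ap f ` el (vsucc E n) \<subseteq> el d"
      then have "ap f ` el n \<subseteq> el d" by auto
      then obtain x where x: "x \<in> el d" "\<forall>i\<in>el n. ap f i \<in> el x" using IH by blast
      let ?y = "vsucc E (ap f n)"
      have "ap f n \<in> el d" using f by auto
      then have y: "?y \<in> el d" by (rule infinite_card_vsucc[OF d])
      have "\<exists>z\<in>el d. el x \<subseteq> el z \<and> el ?y \<subseteq> el z"
        using Ord_subset_linear[OF Ord_mem[OF od x(1)] Ord_mem[OF od y]] x(1) y by blast
      then obtain z where z: "z \<in> el d" "el x \<subseteq> el z" "el ?y \<subseteq> el z" by blast
      have "ap f n \<in> el z" using z(3) by auto
      moreover have "ap f i \<in> el z" if "i \<in> el n" for i using that x(2) z(2) by blast
      ultimately show "\<exists>x\<in>el d. \<forall>i\<in>el (vsucc E n). ap f i \<in> el x" using z(1) by auto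
    qed
  qed
  note bounded = this
  show ?thesis
  proof
    assume "cof n d"
    then obtain f where f: "ap f ` el n \<subseteq> el d" "\<And>x. x \<in> el d \<Longrightarrow> \<exists>y\<in>el n. el x \<subseteq> el (ap f y)"
      by (rule cofE) (rule that)
    obtain x where x: "x \<in> el d" "\<forall>i\<in>el n. ap f i \<in> el x"
      using bounded f(1) by blast
    obtain y where "y \<in> el n" "el x \<subseteq> el (ap f y)" using f(2)[OF x(1)] by blast
    then have "ap f y \<in> el (ap f y)" using x(2) by blast
    then show False by (simp only: not_mem_self)
  qed
qed

section \<open>Countable powers\<close>

abbreviation om1 :: 'v where "om1 \<equiv> omega1 E"
abbreviation seqs :: "'v \<Rightarrow> 'v" where "seqs \<equiv> fun_space E om"

lemma om_mem_om1: "om \<in> el om1" and Card_om1: "Card om1"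
  unfolding omega1_def using card_succ[OF Ord_om] by blast+

lemma Ord_om1 [simp]: "Ord om1"
  by (rule card_Ord[OF Card_om1])

lemma om_subset_om1: "el om \<subseteq> el om1"
  by (rule Ord_mem_subset[OF Ord_om1 om_mem_om1])

lemma is_fun_codomain:
  assumes "is_fun E f a b" "\<And>x. x \<in> el a \<Longrightarrow> ap f x \<in> el c"
  shows "is_fun E f a c"
proof -
  have "\<forall>x\<in>el a. \<exists>!y. opair E x y \<in> el f" using assms(1) unfolding is_fun_def by (elim conjE)
  moreover have "\<forall>p\<in>el f. \<exists>x\<in>el a. \<exists>y\<in>el c. p = opair E x y"
    using is_fun_elt_iff[OF assms(1)] assms(2) by blast
  ultimately show ?thesis unfolding is_fun_def by (intro conjI)
qed

lemma lepoll_fun_space: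
  assumes "lepoll a b"
  shows "lepoll (fun_space E c a) (fun_space E c b)"
proof -
  obtain F where F: "dterm (\<lambda>s. F (s 0))" "F ` el a \<subseteq> el b" "inj_on F (el a)"
    using assms by (rule lepollE)
  note [definability] = dterm_unary[OF F(1)]
  let ?H = "\<lambda>f. lam c (\<lambda>n. F (ap f n))"
  have d: "dterm (\<lambda>s. F (ap f (s 0)))" for f by (intro definability)
  show ?thesis
  proof (rule lepollI)
    show "dterm (\<lambda>s. ?H (s 0))" by (intro definability)
    show "?H ` el (fun_space E c a) \<subseteq> el (fun_space E c b)"
      using is_fun_ap_mem F(2) by (auto intro!: is_fun_lam[OF d])
    show "inj_on ?H (el (fun_space E c a))"
    proof (rule inj_onI)
      fix f g assume fg: "f \<in> el (fun_space E c a)" "g \<in> el (fun_space E c a)" "?H f = ?H g"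
      then have f: "is_fun E f c a" and g: "is_fun E g c a" by simp_all
      have "ap f n = ap g n" if n: "n \<in> el c" for n
      proof -
        have "F (ap f n) = F (ap g n)"
          using fg(3) ap_lam[OF d n, of f] ap_lam[OF d n, of g] by simp
        then show ?thesis
          using F(3) is_fun_ap_mem[OF f n] is_fun_ap_mem[OF g n] by (auto dest: inj_onD)
      qed
      then show "f = g" by (rule is_fun_ext[OF f g])
    qed
  qed
qed

lemma mem_card_exp:
  "Ord a \<Longrightarrow> E a (card_exp E d om) \<longleftrightarrow> \<not> lepoll (seqs d) a"
  unfolding card_exp_def using mem_card_of[of a "seqs d"] by (simp add: elts_def)

text \<open>The least \<open>d\<close> with \<open>d\<^sup>\<omega> > a\<close> has cofinality \<open>\<omega>\<close>: otherwise every function from \<open>\<omega>\<close> to \<open>d\<close> would be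
  bounded, and \<open>d\<^sup>\<omega>\<close> would be a union of at most \<open>a\<close> sets of size at most \<open>a\<close>.\<close>

lemma countable_cofinality_base:
  assumes a: "Card a" "el om \<subseteq> el a" "cofinality E a = om1" "\<not> lepoll (seqs a) a"
    and k: "Ord k" "el om \<subseteq> el k" "lepoll (seqs k) a"
  obtains d where "Card d" "cofinality E d = om" "k \<in> el d" "d \<in> el a" "\<not> lepoll (seqs d) a"
proof -
  have oa: "Ord a" by (rule card_Ord[OF a(1)])
  have df: "definable (\<lambda>s. \<not> lepoll (seqs (s 0)) a)" by (intro definability)
  obtain d where d: "Ord d" "\<not> lepoll (seqs d) a" "el d \<subseteq> el a" "\<And>b. b \<in> el d \<Longrightarrow> \<not> \<not> lepoll (seqs b) a"
    using Ord_least[of "\<lambda>x. \<not> lepoll (seqs x) a" a, OF df oa a(4)] by metis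
  \<comment> \<open>An injection of \<open>d\<close> into a smaller \<open>b\<close> would induce
    one of \<open>seqs d\<close> into \<open>seqs b\<close>, against minimality.\<close>
  have Cd: "Card d" unfolding card_iff
  proof (intro conjI ballI notI)
    show "Ord d" by fact
    fix b assume b: "b \<in> el d" "lepoll d b"
    then show False using d(2,4) lepoll_fun_space lepoll_trans by blast
  qed
  have kd: "k \<in> el d"
  proof (rule ccontr)
    assume "k \<notin> el d"
    then have "el d \<subseteq> el k" using Ord_not_mem[OF k(1) d(1)] by blast
    then have "lepoll (seqs d) (seqs k)" by (intro lepoll_fun_space lepoll_subset)
    then show False using d(2) k(3) lepoll_trans by blast
  qed
  then have od: "el om \<subseteq> el d" using k(2) Ord_mem_subset[OF d(1)] by blast
  have cd: "cof om d"
  proof (rule ccontr)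
    assume n: "\<not> cof om d"
    have "lepoll (seqs d) a"
    proof (rule lepoll_UN[OF a(1,2) d(3)])
      show "dterm (\<lambda>s. seqs (s 0))" by (intro definability)
      show "\<And>i. i \<in> el d \<Longrightarrow> lepoll (seqs i) a" using d(4) by blast
      show "el (seqs d) \<subseteq> (\<Union>i\<in>el d. el (seqs i))"
      proof
        fix f assume "f \<in> el (seqs d)"
        then have f: "is_fun E f om d" by simp
        have "ap f ` el om \<subseteq> el d" using is_fun_ap_mem[OF f] by blast
        with n dterm_ap1 have "\<not> (\<forall>x\<in>el d. \<exists>y\<in>el om. el x \<subseteq> el (ap f y))"
          using cofI[of "ap f"] by blast
        then obtain x where x: "x \<in> el d" "\<And>y. y \<in> el om \<Longrightarrow> \<not> el x \<subseteq> el (ap f y)"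
          by blast
        have "ap f y \<in> el x" if "y \<in> el om" for y
          using x(2)[OF that] Ord_not_mem[OF Ord_mem[OF d(1) is_fun_ap_mem[OF f that]] Ord_mem[OF d(1) x(1)]]
          by blast
        then have "is_fun E f om x" using is_fun_codomain[OF f] by blast
        then show "f \<in> (\<Union>i\<in>el d. el (seqs i))" using x(1) by auto
      qed
    qed
    then show False using d(2) by blast
  qed
  \<comment> \<open>\<open>d\<close> is at most \<open>a\<close> and differs from it in cofinality,
    so it lies strictly below.\<close>
  have "\<not> cof om a" using a(3) om_mem_om1 unfolding cofinality_eq_iff[OF oa] by blast
  then have "d \<noteq> a" using cd by blast
  then have da: "d \<in> el a" using Ord_psubset[OF d(1) oa] d(3) by (metis eqI psubsetI)
  have "cofinality E d = om"
    unfolding cofinality_eq_iff[OF d(1)] using cd not_cof_finite[OF Cd od] Ord_om by blast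
  then show ?thesis using that Cd kd da d(2) by blast
qed

section \<open>Iterated cardinal successors\<close>

text \<open>An injection of the union into one of its elements \<open>b\<close> restricts to a
  member of \<open>S\<close> containing \<open>b\<close>, contradicting that this member is a
  cardinal.\<close>

lemma Card_Union:
  assumes "small (\<Union>x\<in>S. el x)" "\<And>x. x \<in> S \<Longrightarrow> Card x"
  shows "Card (setof (\<Union>x\<in>S. el x))"
  unfolding card_iff el_setof[OF assms(1)]
proof (intro conjI ballI notI)
  show "Ord (setof (\<Union>x\<in>S. el x))"
  proof (rule Ord_trans_of_Ords)
    fix y assume "y \<in> el (setof (\<Union>x\<in>S. el x))"
    then obtain x where x: "x \<in> S" "y \<in> el x" unfolding el_setof[OF assms(1)] by blast
    have "Ord x" by (rule card_Ord[OF assms(2)[OF x(1)]])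
    then show "Ord y" using x(2) by (rule Ord_mem)
    have "el y \<subseteq> el x" using \<open>Ord x\<close> x(2) by (rule Ord_mem_subset)
    then show "el y \<subseteq> el (setof (\<Union>x\<in>S. el x))" unfolding el_setof[OF assms(1)] using x(1) by blast
  qed
  fix b assume b: "b \<in> (\<Union>x\<in>S. el x)" "lepoll (setof (\<Union>x\<in>S. el x)) b"
  then obtain x where x: "x \<in> S" "b \<in> el x" by blast
  have "lepoll x (setof (\<Union>x\<in>S. el x))" by (rule lepoll_subset, unfold el_setof[OF assms(1)]) (use x in blast)
  then have "lepoll x b" using b(2) lepoll_trans by blast
  then show False using x assms(2) unfolding card_iff by blast
qed

text \<open>The recursion clauses inside \<open>card_succ_iter\<close>, stated for a HOL function so
  that an enumeration of cardinals can be tested against them.\<close>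

definition succ_seq :: "'v \<Rightarrow> 'v \<Rightarrow> ('v \<Rightarrow> 'v) \<Rightarrow> bool" where
  "succ_seq d x F \<longleftrightarrow> F (vempty E) = d \<and>
     (\<forall>y. vsucc E y \<in> el (vsucc E x) \<longrightarrow> F (vsucc E y) = card_succ E (F y)) \<and>
     (\<forall>y\<in>el (vsucc E x). limit_ordinal E y \<longrightarrow> el (F y) = (\<Union>z\<in>el y. el (F z)))"

text \<open>The graph of \<open>F\<close> on the successor of \<open>x\<close> is a witness for the
  description; any other witness agrees with \<open>F\<close> by induction on the index.\<close>

lemma card_succ_iter_eq:
  assumes x: "Ord x" and F: "dterm (\<lambda>s. F (s 0))" and seq: "succ_seq d x F"
  shows "card_succ_iter E d x = F x"
proof -
  note [definability] = dterm_unary[OF F]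
  have seq0: "F (vempty E) = d"
    and seqS: "vsucc E y \<in> el (vsucc E x) \<Longrightarrow> F (vsucc E y) = card_succ E (F y)"
    and seqL: "y \<in> el (vsucc E x) \<Longrightarrow> limit_ordinal E y \<Longrightarrow> el (F y) = (\<Union>z\<in>el y. el (F z))" for y
    using seq unfolding succ_seq_def by blast+
  have ox: "Ord (vsucc E x)" by (rule Ord_vsucc[OF x])
  let ?Q = "\<lambda>f b. is_fun E f (vsucc E x) b \<and> app E f (vempty E) = d \<and>
     (\<forall>y. vsucc E y \<in> el (vsucc E x) \<longrightarrow> app E f (vsucc E y) = card_succ E (app E f y)) \<and>
     (\<forall>y\<in>el (vsucc E x). limit_ordinal E y \<longrightarrow> el (app E f y) = (\<Union>z\<in>el y. el (app E f z)))"
  have e: "vempty E \<in> el (vsucc E x)"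
    using Ord_not_mem[OF Ord_vempty ox] by auto
  have sub: "y \<in> el (vsucc E x)" if "vsucc E y \<in> el (vsucc E x)" for y
    using vsucc_mem_vsucc[OF x] that by simp
  have sub': "z \<in> el (vsucc E x)" if "y \<in> el (vsucc E x)" "z \<in> el y" for y z
    using Ord_mem_trans[OF ox that(2,1)] .
  show ?thesis unfolding card_succ_iter_def
  proof (rule the_equality)
    let ?f = "lam (vsucc E x) F"
    have f: "is_fun E ?f (vsucc E x) (setof (F ` el (vsucc E x)))"
      by (rule is_fun_lam[OF F], subst el_setof[OF small_image[OF F small_el]]) simp
    have app: "app E ?f y = F y" if "y \<in> el (vsucc E x)" for y
      using app_eq_ap[OF f that] ap_lam[OF F that] by simp
    have "?Q ?f (setof (F ` el (vsucc E x)))"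
    proof (intro conjI allI ballI impI)
      show "app E ?f (vempty E) = d" using app[OF e] seq0 by simp
      show "app E ?f (vsucc E y) = card_succ E (app E ?f y)" if "vsucc E y \<in> el (vsucc E x)" for y
        unfolding app[OF that] app[OF sub[OF that]] by (rule seqS[OF that])
      fix y assume y: "y \<in> el (vsucc E x)" "limit_ordinal E y"
      have "(\<Union>z\<in>el y. el (app E ?f z)) = (\<Union>z\<in>el y. el (F z))"
        by (rule SUP_cong[OF refl]) (use app[OF sub'[OF y(1)]] in simp)
      then show "el (app E ?f y) = (\<Union>z\<in>el y. el (app E ?f z))"
        using app[OF y(1)] seqL[OF y] by simp
    qed (rule f)
    moreover have "F x = app E ?f x" by (rule app[symmetric]) simp
    ultimately show "\<exists>f b. is_fun E f (vsucc E x) b \<and> app E f (vempty E) = d \<and>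
     (\<forall>y. vsucc E y \<in> el (vsucc E x) \<longrightarrow> app E f (vsucc E y) = card_succ E (app E f y)) \<and>
     (\<forall>y\<in>el (vsucc E x). limit_ordinal E y \<longrightarrow> el (app E f y) = (\<Union>z\<in>el y. el (app E f z))) \<and>
      F x = app E f x" by blast
  next
    fix k assume "\<exists>f b. is_fun E f (vsucc E x) b \<and> app E f (vempty E) = d \<and>
     (\<forall>y. vsucc E y \<in> el (vsucc E x) \<longrightarrow> app E f (vsucc E y) = card_succ E (app E f y)) \<and>
     (\<forall>y\<in>el (vsucc E x). limit_ordinal E y \<longrightarrow> el (app E f y) = (\<Union>z\<in>el y. el (app E f z))) \<and>
      k = app E f x"
    then obtain f b where f: "?Q f b" and k: "k = app E f x" by blast
    from f have f1: "is_fun E f (vsucc E x) b" by blast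
    have "y \<in> el (vsucc E x) \<longrightarrow> ap f y = F y" if "Ord y" for y
    proof (rule Ord_induct[of "\<lambda>y. y \<in> el (vsucc E x) \<longrightarrow> ap f y = F y", OF _ that])
      show "definable (\<lambda>s. s 0 \<in> el (vsucc E x) \<longrightarrow> ap f (s 0) = F (s 0))" by (intro definability)
      fix y assume y: "Ord y" and IH: "\<And>z. z \<in> el y \<Longrightarrow> z \<in> el (vsucc E x) \<longrightarrow> ap f z = F z"
      show "y \<in> el (vsucc E x) \<longrightarrow> ap f y = F y"
      proof
        assume yx: "y \<in> el (vsucc E x)"
        then have ay: "ap f y = app E f y" by (rule app_eq_ap[OF f1, symmetric])
        have IH': "app E f z = F z" if "z \<in> el y" for z
          using IH[OF that] sub'[OF yx that] app_eq_ap[OF f1 sub'[OF yx that]] by metis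
        from y show "ap f y = F y"
        proof (cases rule: Ord_cases)
          case 1
          then show ?thesis using f seq0 ay by simp
        next
          case (2 z)
          then have "app E f z = F z" by (intro IH') simp
          moreover have "app E f y = card_succ E (app E f z)" using f yx 2(2) by blast
          moreover have "F y = card_succ E (F z)" using seqS[of z] yx unfolding 2(2) by blast
          ultimately show ?thesis using ay by simp
        next
          case 3
          have "el (app E f y) = (\<Union>z\<in>el y. el (app E f z))" using f yx 3 by blast
          also have "\<dots> = (\<Union>z\<in>el y. el (F z))"
            by (rule SUP_cong[OF refl]) (simp add: IH')
          also have "\<dots> = el (F y)" using seqL[OF yx 3] by simp
          finally show ?thesis using ay by simp
        qed
      qed
    qed
    then have "ap f x = F x" using x by simp
    then show "k = F x" using k app_eq_ap[OF f1, of x] by simp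
  qed
qed

text \<open>Enumerate the cardinals in \<open>[d, a]\<close> increasingly. If this took at most \<open>\<omega>\<^sub>1\<close> steps, the index of \<open>a\<close>
  would be a successor or a limit below \<open>\<omega>\<^sub>1\<close>, making \<open>a\<close> regular or of cofinality below \<open>\<omega>\<^sub>1\<close>.\<close>

lemma card_succ_iter_om1_subset:
  assumes a: "Card a" "cofinality E a = om1" and d: "Card d" "el om1 \<subseteq> el d" "d \<in> el a"
  shows "Ord (card_succ_iter E d om1)" "el (card_succ_iter E d om1) \<subseteq> el a"
proof -
  have oa: "Ord a" by (rule card_Ord[OF a(1)])
  have cof_a: "cof om1 a" "\<And>c. c \<in> el om1 \<Longrightarrow> \<not> cof c a"
    using a(2) unfolding cofinality_eq_iff[OF oa] by blast+
  \<comment> \<open>The successor of \<open>a\<close> is the cut-off, so that \<open>a\<close>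
    itself is listed.\<close>
  define K where "K = setof {k \<in> el (vsucc E a). Card k \<and> el d \<subseteq> el k}"
  have sK: "small {k \<in> el (vsucc E a). Card k \<and> el d \<subseteq> el k}"
    by (rule small_separation[OF _ small_el[of "vsucc E a"]], intro definability) blast
  have K: "k \<in> el K \<longleftrightarrow> Card k \<and> el d \<subseteq> el k \<and> el k \<subseteq> el a" for k
  proof -
    have "k \<in> el (vsucc E a) \<longleftrightarrow> el k \<subseteq> el a" if "Ord k"
      using Ord_not_mem[OF oa that] Ord_linear[OF that oa] Ord_not_mem[OF that oa]
        Ord_mem_subset[OF oa, of k] not_mem_self by auto
    then show ?thesis unfolding K_def el_setof[OF sK] using card_Ord by blast
  qed
  have dK: "d \<in> el K" unfolding K using d Ord_mem_subset[OF oa d(3)] by blast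
  have aK: "a \<in> el K" unfolding K using a(1) Ord_mem_subset[OF oa d(3)] by blast
  have oK: "Ord k" if "k \<in> el K" for k using that card_Ord unfolding K by blast
  \<comment> \<open>The rank of a cardinal is the cardinal itself, which makes the list
    increasing.\<close>
  obtain th F where F: "Ord th" "dterm (\<lambda>s. F (s 0))" "bij_betw F (el th) (el K)"
    "\<And>x y. x \<in> el th \<Longrightarrow> y \<in> el x \<Longrightarrow> el (F y) \<subseteq> el (F x)"
    using enumeration[of "\<lambda>x. x" K, OF dterm_var oK] by blast
  have FK: "F x \<in> el K" if "x \<in> el th" for x using bij_betwE[OF F(3)] that by blast
  have mono: "F y \<in> el (F x)" if "x \<in> el th" "y \<in> el x" for x y
  proof -
    have y: "y \<in> el th" by (rule Ord_mem_trans[OF F(1) that(2,1)])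
    have "F x \<noteq> F y"
      using bij_betw_imp_inj_on[OF F(3)] that y not_mem_self[of x] by (metis inj_onD)
    then show ?thesis
      using F(4)[OF that] Ord_psubset[OF oK[OF FK[OF y]] oK[OF FK[OF that(1)]]] by (metis eqI psubsetI)
  qed
  \<comment> \<open>Each value is the least member of \<open>K\<close> above all earlier values. The
    recursion clauses follow by comparing it with \<open>d\<close>, with a cardinal successor and
    with a union, once these are seen to lie in \<open>K\<close>.\<close>
  have least: "el (F x) \<subseteq> el k" if x: "x \<in> el th" and k: "k \<in> el K" and lt: "\<And>y. y \<in> el x \<Longrightarrow> F y \<in> el k" for x k
  proof -
    obtain z where z: "z \<in> el th" "k = F z" using F(3) k unfolding bij_betw_def by blast
    have "z \<notin> el x" using lt[of z] z(2) not_mem_self by blast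
    then have "x = z \<or> x \<in> el z" using Ord_linear Ord_mem[OF F(1)] z(1) x by blast
    then show ?thesis using F(4)[OF z(1)] z(2) by blast
  qed
  have F0: "F (vempty E) = d" if "vempty E \<in> el th"
    using least[OF that dK] FK[OF that] unfolding K by (intro eqI) auto
  have Fsucc: "F (vsucc E y) = card_succ E (F y)" if y: "vsucc E y \<in> el th" for y
  proof -
    have y': "y \<in> el th" using Ord_mem_trans[OF F(1) _ y] by simp
    have cy: "Card (F y)" "el d \<subseteq> el (F y)" using FK[OF y'] unfolding K by blast+
    note c = card_succ[OF card_Ord[OF cy(1)]]
    have "F y \<in> el (F (vsucc E y))" by (rule mono[OF y]) simp
    then have 1: "el (card_succ E (F y)) \<subseteq> el (F (vsucc E y))"
      using c(3) FK[OF y] unfolding K by blast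
    have sub: "el (F y) \<subseteq> el (card_succ E (F y))" by (rule Ord_mem_subset[OF card_Ord[OF c(1)] c(2)])
    then have cK: "card_succ E (F y) \<in> el K" using c(1) 1 cy FK[OF y] unfolding K by blast
    have "el (F (vsucc E y)) \<subseteq> el (card_succ E (F y))"
    proof (rule least[OF y cK])
      show "F z \<in> el (card_succ E (F y))" if "z \<in> el (vsucc E y)" for z
        using that c(2) sub mono[OF y', of z] by auto
    qed
    then show ?thesis using 1 by (intro eqI) blast
  qed
  have Flim: "el (F y) = (\<Union>z\<in>el y. el (F z))" if y: "y \<in> el th" and lim: "limit_ordinal E y" for y
  proof -
    have oy: "Ord y" by (rule Ord_mem[OF F(1) y])
    have yth: "el y \<subseteq> el th" by (rule Ord_mem_subset[OF F(1) y])
    have lim': "el y \<noteq> {}" "\<And>z. z \<in> el y \<Longrightarrow> vsucc E z \<in> el y"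
      using lim unfolding limit_ordinal_iff[OF oy] by blast+
    let ?U = "setof (\<Union>z\<in>el y. el (F z))"
    have elU: "el ?U = (\<Union>z\<in>el y. el (F z))" by (intro el_setof small_UN F(2) small_el)
    have "Card (setof (\<Union>k\<in>F ` el y. el k))"
    proof (rule Card_Union)
      show "small (\<Union>k\<in>F ` el y. el k)" using small_UN[OF F(2) small_el] by simp
      show "\<And>x. x \<in> F ` el y \<Longrightarrow> Card x" using FK yth unfolding K by blast
    qed
    then have "Card ?U" by simp
    moreover have "el d \<subseteq> el ?U" unfolding elU using lim'(1) FK yth unfolding K by blast
    moreover have sub: "el ?U \<subseteq> el (F y)" unfolding elU using F(4)[OF y] by blast
    ultimately have UK: "?U \<in> el K" using FK[OF y] unfolding K by blast
    have "el (F y) \<subseteq> el ?U"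
    proof (rule least[OF y UK])
      show "F z \<in> el ?U" if z: "z \<in> el y" for z
        unfolding elU using mono[of "vsucc E z" z] lim'(2)[OF z] yth by auto
    qed
    then show ?thesis using sub elU by blast
  qed
  have om1_th: "om1 \<in> el th"
  proof (rule ccontr)
    assume "om1 \<notin> el th"
    then have thsub: "el th \<subseteq> el om1" using Ord_not_mem[OF Ord_om1 F(1)] by blast
    have "a \<in> F ` el th" unfolding bij_betw_imp_surj_on[OF F(3)] by (rule aK)
    then obtain e where e: "e \<in> el th" "F e = a" by blast
    have e1: "e \<in> el om1" using e(1) thsub by blast
    from Ord_mem[OF F(1) e(1)] show False
    proof (cases rule: Ord_cases)
      case 1
      then have "a = d" using F0 e by simp
      then show False using d(3) by simp
    next
      case (2 y)
      have y: "y \<in> el th" using Ord_mem_trans[OF F(1) _ e(1)] 2(2) by simp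
      have ae: "a = card_succ E (F y)" using Fsucc[of y] e 2(2) by simp
      have c: "Card (F y)" "el om1 \<subseteq> el (F y)" using FK[OF y] d(2) unfolding K by blast+
      obtain f where f: "ap f ` el om1 \<subseteq> el a" "\<And>x. x \<in> el a \<Longrightarrow> \<exists>i\<in>el om1. el x \<subseteq> el (ap f i)"
        using cof_a(1) by (rule cofE) (rule that)
      \<comment> \<open>Here omega_1 \<le> \<open>d\<close> matters: the predecessor
        \<open>F y\<close> is at least omega_1, so a map from omega_1 into its successor
        \<open>a\<close> is bounded and cannot be cofinal.\<close>
      have "\<exists>x\<in>el (card_succ E (F y)). \<forall>i\<in>el om1. ap f i \<in> el x"
      proof (rule card_succ_regular[OF c(1) _ c(2) dterm_ap1])
        show "el om \<subseteq> el (F y)" using c(2) om_subset_om1 by blast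
        show "\<And>i. i \<in> el om1 \<Longrightarrow> ap f i \<in> el (card_succ E (F y))" using f(1) ae by blast
      qed
      then obtain x where x: "x \<in> el a" "\<And>i. i \<in> el om1 \<Longrightarrow> ap f i \<in> el x" unfolding ae by blast
      then obtain i where "i \<in> el om1" "el x \<subseteq> el (ap f i)" using f(2) by blast
      then have "ap f i \<in> el (ap f i)" using x(2) by blast
      then show False by (simp only: not_mem_self)
    next
      case 3
      \<comment> \<open>At a limit index the list itself is cofinal in \<open>a\<close>, with length
        \<open>e\<close> below omega_1.\<close>
      have "cof e a"
      proof (rule cofI[OF F(2)])
        show "F ` el e \<subseteq> el a" using mono[OF e(1)] e(2) by blast
        fix x assume "x \<in> el a"
        then obtain z where z: "z \<in> el e" "x \<in> el (F z)" using Flim[OF e(1) 3] e(2) by auto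
        have "Ord (F z)" using oK FK Ord_mem_trans[OF F(1) z(1) e(1)] by blast
        then show "\<exists>y\<in>el e. el x \<subseteq> el (F y)" using z Ord_mem_subset by blast
      qed
      then show False using cof_a(2)[OF e1] by blast
    qed
  qed
  have sub: "el (vsucc E om1) \<subseteq> el th" using om1_th Ord_mem_subset[OF F(1) om1_th] by simp
  have "vempty E \<in> el th"
    using Ord_not_mem[OF Ord_vempty F(1)] om1_th by auto
  then have "succ_seq d om1 F"
    unfolding succ_seq_def using F0 Fsucc Flim sub by blast
  then have "card_succ_iter E d om1 = F om1"
    by (rule card_succ_iter_eq[OF Ord_om1 F(2)])
  then show "Ord (card_succ_iter E d om1)" "el (card_succ_iter E d om1) \<subseteq> el a"
    using FK[OF om1_th] oK[OF FK[OF om1_th]] unfolding K by simp_all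
qed

lemma proper_class_iff: "proper_class E S \<longleftrightarrow> \<not> small S"
  by (simp add: proper_class_def small_def)

end

section \<open>From a proper class of \<alpha> to a proper class of \<delta>\<close>

theorem theorem3p2:
  fixes E :: "'v \<Rightarrow> 'v \<Rightarrow> bool"
  assumes "ZFC_model E"
    and "proper_class E
      {\<alpha>. cardinal E \<alpha> \<and> cofinality E \<alpha> = omega1 E \<and> E \<alpha> (card_exp E \<alpha> (omega E))}"
  shows "proper_class E
      {\<delta>. cardinal E \<delta> \<and> cofinality E \<delta> = omega E \<and>
          ord_le E (card_succ E (card_succ_iter E \<delta> (omega1 E))) (card_exp E \<delta> (omega E))}"
    (is "proper_class E ?D")
proof -
  interpret zfc E by (rule zfc.intro) fact
  let ?C = "{\<alpha>. cardinal E \<alpha> \<and> cofinality E \<alpha> = omega1 E \<and> E \<alpha> (card_exp E \<alpha> (omega E))}"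
  have C: "x \<in> ?C \<longleftrightarrow> Card x \<and> (cof om1 x \<and> (\<forall>c\<in>el om1. \<not> cof c x)) \<and> \<not> lepoll (seqs x) x" for x
    using cofinality_eq_iff[of x om1] mem_card_exp[of x x] card_Ord[of x] by auto
  have dC: "definable (\<lambda>s. s 0 \<in> ?C)"
    unfolding C by (intro definability)
  \<comment> \<open>If no member exceeded \<open>b\<close>, the definable class would lie inside the
    successor of \<open>b\<close> and be a set by Separation.\<close>
  have unbounded: "\<exists>\<alpha>\<in>?C. b \<in> el \<alpha>" if "Ord b" for b
  proof (rule ccontr)
    assume n: "\<not> ?thesis"
    have "x \<in> el (vsucc E b)" if x: "x \<in> ?C" for x
    proof -
      have "Ord x" using x card_Ord by blast
      then show ?thesis using n x Ord_linear[OF \<open>Ord b\<close>, of x] by auto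
    qed
    then have "small ?C" by (intro small_separation[OF dC small_el[of "vsucc E b"]]) blast
    then show False using assms(2) by (simp add: proper_class_iff)
  qed
  show ?thesis unfolding proper_class_iff
  proof
    assume sD: "small ?D"
    let ?U = "setof (\<Union>x\<in>el (setof ?D). el x)"
    have oU: "Ord ?U" by (rule Ord_Union) (use card_Ord el_setof[OF sD] in blast)
    have elU: "el ?U = (\<Union>x\<in>?D. el x)" using small_Union[of "setof ?D"] el_setof[OF sD] by simp
    \<comment> \<open>\<open>k\<close> bounds every member of \<open>?D\<close> and is at least
      omega_1, so any base found above \<open>k\<close> is above both.\<close>
    obtain k where k: "Ord k" "el ?U \<subseteq> el k" "el om1 \<subseteq> el k"
      using Ord_subset_linear[OF oU Ord_om1] oU Ord_om1 by blast
    have omk: "el om \<subseteq> el k" using k(3) om_subset_om1 by blast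
    \<comment> \<open>The \<omega>-th power of \<open>k\<close>: choosing \<open>a\<close> above it
      embeds \<open>seqs k\<close> in \<open>a\<close>, which forces the least base \<open>d\<close>
      above \<open>k\<close>.\<close>
    let ?l = "card_of E (seqs k)"
    obtain b where b: "Ord b" "el k \<subseteq> el b" "el ?l \<subseteq> el b"
      using Ord_subset_linear[OF k(1) card_of(1)] k(1) card_of(1) by blast
    obtain a where a: "a \<in> ?C" "b \<in> el a" using unbounded[OF b(1)] by blast
    have Ca: "Card a" "cofinality E a = om1" using a(1) by blast+
    have pa: "\<not> lepoll (seqs a) a" using a(1) unfolding C by blast
    have ba: "el b \<subseteq> el a" by (rule Ord_mem_subset[OF card_Ord[OF Ca(1)] a(2)])
    have la: "lepoll (seqs k) a"
      using card_of_lepoll(2) lepoll_subset[of ?l a] lepoll_trans b(3) ba by blast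
    have oma: "el om \<subseteq> el a" using omk b(2) ba by blast
    obtain d where d: "Card d" "cofinality E d = om" "k \<in> el d" "d \<in> el a" "\<not> lepoll (seqs d) a"
      by (rule countable_cofinality_base[OF Ca(1) oma Ca(2) pa k(1) omk la])
    have kd: "el k \<subseteq> el d" by (rule Ord_mem_subset[OF card_Ord[OF d(1)] d(3)])
    then have "el om1 \<subseteq> el d" using k(3) by blast
    note i = card_succ_iter_om1_subset[OF Ca d(1) this d(4)]
    \<comment> \<open>The iterated successor is at most \<open>a\<close>, and \<open>seqs d\<close>
      does not even embed in \<open>a\<close>.\<close>
    have "\<not> lepoll (seqs d) (card_succ_iter E d om1)"
      using d(5) lepoll_subset[OF i(2)] lepoll_trans by blast
    then have "card_succ_iter E d om1 \<in> el (card_exp E d om)"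
      unfolding card_exp_def using mem_card_of[OF i(1)] by blast
    then have "el (card_succ E (card_succ_iter E d om1)) \<subseteq> el (card_exp E d om)"
      using card_succ(3)[OF i(1)] card_of(3) unfolding card_exp_def by blast
    then have "ord_le E (card_succ E (card_succ_iter E d om1)) (card_exp E d om)"
      using ord_le_iff card_Ord[OF card_succ(1)[OF i(1)]] card_of(1) unfolding card_exp_def by blast
    \<comment> \<open>The contradiction: a member of \<open>?D\<close> that lies above its bound
      \<open>k\<close>.\<close>
    then have "d \<in> ?D" using d by blast
    then have "el d \<subseteq> el ?U" unfolding elU by blast
    then have "k \<in> el k" using d(3) k(2) by blast
    then show False by (simp only: not_mem_self)
  qed
qed

end
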